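(* Let $\mathcal{M}=\mathcal{M}(\Sigma,I)$ be a trace monoid acting partially and irreducibly on a finite set $X_0$, with characteristic root $t_0$ and Parry cocycle $\Gamma$. Then there exists a family $\nu=(\nu_\alpha)_{\alpha\in X_0}$ of probability measures on $\partial\mathcal{M}$ such that: for all $\alpha\in X_0$ and $x\in\mathcal{M}_\alpha$, $\nu_\alpha(\uparrow x)=t_0^{|x|}\Gamma(\alpha,\alpha\cdot x)$; $\nu_\alpha(\uparrow x)=0$ for $x\notin\mathcal{M}_\alpha$; and for all $\alpha\in X_0$ and $x,y\in\mathcal{M}$ with $x\in\mathcal{M}_\alpha$, $\nu_\alpha(\uparrow(x\cdot y))=\nu_\alpha(\uparrow x)\,\nu_{\alpha\cdot x}(\uparrow y)$. In particular $\nu_\alpha(\uparrow x)>0$ if and only if $x\in\mathcal{M}_\alpha$.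
   Context: Trace monoid: $\Sigma$ finite, $|\Sigma|\ge2$, $I$ irreflexive symmetric, $\mathcal{M}=\Sigma^*/\langle ab=ba,(a,b)\in I\rangle$, unit $1$, length $|x|$, $x\le y$ iff $y=x\cdot z$. Cliques: traces $a_1\cdots a_k$ of pairwise distinct letters pairwise in $I$; $\mathfrak{C}$ nonempty cliques; $c\parallel c'$ if $c\cdot c'$ is a clique; $c\to c'$ if each $b\in c'$ has $a\in c$ with $(a,b)\notin I$. Each nonempty trace is uniquely $c_1\cdots c_n$, $c_i\in\mathfrak{C}$, $c_i\to c_{i+1}$; $\tau(x)=n$. $\partial\mathcal{M}$: infinite sequences $(c_i)_{i\ge1}$ in $\mathfrak{C}$ with $c_i\to c_{i+1}$; $x\le(c_i)$ iff $x\le c_1\cdots c_{\tau(x)}$; $\uparrow x=\{\xi\in\partial\mathcal{M}:x\le\xi\}$; $\sigma$-algebra generated by these. Partial action: nonempty $\Sigma(\alpha)\subseteq\Sigma$ for $\alpha\in X_0$, maps $a\in\Sigma(\alpha)\mapsto\alpha\cdot a\in X_0$, such that if $a\in\Sigma(\alpha)$, $a\parallel b$: either $b\in\Sigma(\alpha)$ and $a\in\Sigma(\alpha\cdot b)$, $b\in\Sigma(\alpha\cdot a)$, $(\alpha\cdot a)\cdot b=(\alpha\cdot b)\cdot a$; or $b\notin\Sigma(\alpha)$ and $b\notin\Sigma(\alpha\cdot a)$. Total action: the unique right action on $X_0\cup\{\bot\}$ extending this with $\alpha\cdot a=\bot$ for $a\notin\Sigma(\alpha)$, $\bot\cdot a=\bot$.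 $\mathcal{M}_\alpha=\{x:\alpha\cdot x\neq\bot\}$. Sub-action: nonempty $Y\subseteq X_0$ with $\alpha\cdot a\in Y$ for $\alpha\in Y$, $a\in\Sigma(\alpha)$; irreducible: $X_0$ contains no sub-action other than itself. $Z_\alpha(t)=\sum_{x\in\mathcal{M}_\alpha}t^{|x|}$; its radius of convergence is, under irreducibility, independent of $\alpha$: this is the characteristic root $t_0$. The Parry cocycle is $\Gamma(\alpha,\beta)=\lim_{t\to t_0^-}Z_\beta(t)/Z_\alpha(t)\in(0,\infty)$ for $\alpha,\beta\in X_0$. *)

theory Defs
  imports "HOL-Algebra.Divisibility" "HOL-Probability.Probability"
begin

section \<open>Trace monoids\<close>

locale trace_alphabet =
  fixes \<Sigma> :: "'a set" and I :: "'a rel"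
  assumes finite_alphabet: "finite \<Sigma>"
    and card_alphabet: "card \<Sigma> \<ge> 2"
    and indep_subset: "I \<subseteq> \<Sigma> \<times> \<Sigma>"
    and indep_irrefl: "irrefl I"
    and indep_sym: "sym I"

text \<open>The least congruence on the free monoid \<open>lists \<Sigma>\<close> that identifies \<open>ab\<close> with \<open>ba\<close>
  whenever \<open>(a, b) \<in> I\<close>.\<close>

inductive_set trace_rel :: "'a set \<Rightarrow> 'a rel \<Rightarrow> 'a list rel"
  for \<Sigma> :: "'a set" and I :: "'a rel" where
  commute: "(a, b) \<in> I \<Longrightarrow> ([a, b], [b, a]) \<in> trace_rel \<Sigma> I"
| refl: "w \<in> lists \<Sigma> \<Longrightarrow> (w, w) \<in> trace_rel \<Sigma> I"
| sym: "(u, v) \<in> trace_rel \<Sigma> I \<Longrightarrow> (v, u) \<in> trace_rel \<Sigma> I"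
| trans: "(u, v) \<in> trace_rel \<Sigma> I \<Longrightarrow> (v, w) \<in> trace_rel \<Sigma> I \<Longrightarrow> (u, w) \<in> trace_rel \<Sigma> I"
| append: "(u, u') \<in> trace_rel \<Sigma> I \<Longrightarrow> (v, v') \<in> trace_rel \<Sigma> I \<Longrightarrow>
    (u @ v, u' @ v') \<in> trace_rel \<Sigma> I"

type_synonym 'a trace = "'a list set"

definition trace_of :: "'a set \<Rightarrow> 'a rel \<Rightarrow> 'a list \<Rightarrow> 'a trace" where
  "trace_of \<Sigma> I w = trace_rel \<Sigma> I `` {w}"

definition trace_monoid :: "'a set \<Rightarrow> 'a rel \<Rightarrow> 'a trace monoid" where
  "trace_monoid \<Sigma> I =
     \<lparr>carrier = lists \<Sigma> // trace_rel \<Sigma> I,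
      mult = (\<lambda>x y. \<Union>u\<in>x. \<Union>v\<in>y. trace_of \<Sigma> I (u @ v)),
      one = trace_of \<Sigma> I []\<rparr>"

text \<open>Equivalent words have the same length and the same letters, so the next two
  definitions do not depend on representatives.\<close>

definition trace_length :: "'a trace \<Rightarrow> nat" where
  "trace_length x = the_elem (length ` x)"

definition letters :: "'a trace \<Rightarrow> 'a set" where
  "letters x = \<Union> (set ` x)"

definition trace_prod :: "'a set \<Rightarrow> 'a rel \<Rightarrow> 'a trace list \<Rightarrow> 'a trace" where
  "trace_prod \<Sigma> I xs = foldr (mult (trace_monoid \<Sigma> I)) xs (one (trace_monoid \<Sigma> I))"


section \<open>Cliques and the Cartier-Foata normal form\<close>

definition is_clique :: "'a set \<Rightarrow> 'a rel \<Rightarrow> 'a trace \<Rightarrow> bool" where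
  "is_clique \<Sigma> I c \<longleftrightarrow>
     (\<exists>w\<in>lists \<Sigma>. distinct w \<and> pairwise (\<lambda>a b. (a, b) \<in> I) (set w) \<and> c = trace_of \<Sigma> I w)"

definition nonempty_cliques :: "'a set \<Rightarrow> 'a rel \<Rightarrow> 'a trace set" where
  "nonempty_cliques \<Sigma> I = {c. is_clique \<Sigma> I c \<and> c \<noteq> \<one>\<^bsub>trace_monoid \<Sigma> I\<^esub>}"

definition clique_parallel :: "'a set \<Rightarrow> 'a rel \<Rightarrow> 'a trace \<Rightarrow> 'a trace \<Rightarrow> bool" where
  "clique_parallel \<Sigma> I c c' \<longleftrightarrow> is_clique \<Sigma> I (c \<otimes>\<^bsub>trace_monoid \<Sigma> I\<^esub> c')"

definition normal_arrow :: "'a rel \<Rightarrow> 'a trace \<Rightarrow> 'a trace \<Rightarrow> bool" where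
  "normal_arrow I c c' \<longleftrightarrow> (\<forall>b\<in>letters c'. \<exists>a\<in>letters c. (a, b) \<notin> I)"

definition normal_form :: "'a set \<Rightarrow> 'a rel \<Rightarrow> 'a trace \<Rightarrow> 'a trace list" where
  "normal_form \<Sigma> I x =
     (THE cs. set cs \<subseteq> nonempty_cliques \<Sigma> I \<and> successively (normal_arrow I) cs \<and>
              trace_prod \<Sigma> I cs = x)"

definition height :: "'a set \<Rightarrow> 'a rel \<Rightarrow> 'a trace \<Rightarrow> nat" where
  "height \<Sigma> I x = length (normal_form \<Sigma> I x)"


section \<open>The boundary at infinity\<close>

definition boundary :: "'a set \<Rightarrow> 'a rel \<Rightarrow> (nat \<Rightarrow> 'a trace) set" where
  "boundary \<Sigma> I =
     {\<xi>. \<forall>i. \<xi> i \<in> nonempty_cliques \<Sigma> I \<and> normal_arrow I (\<xi> i) (\<xi> (Suc i))}"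

text \<open>Sequences are indexed from \<open>0\<close>, so \<open>\<xi> 0, \<dots>, \<xi> (height \<Sigma> I x - 1)\<close> are the first
  \<open>height \<Sigma> I x\<close> cliques of \<open>\<xi>\<close>. The library's \<open>divides\<close> is divisibility on the left:
  \<open>x\<close> divides \<open>y\<close> iff \<open>y = x \<otimes> z\<close> for some \<open>z\<close>.\<close>

definition cylinder :: "'a set \<Rightarrow> 'a rel \<Rightarrow> 'a trace \<Rightarrow> (nat \<Rightarrow> 'a trace) set" where
  "cylinder \<Sigma> I x =
     {\<xi> \<in> boundary \<Sigma> I.
        x divides\<^bsub>trace_monoid \<Sigma> I\<^esub> trace_prod \<Sigma> I (map \<xi> [0..<height \<Sigma> I x])}"

definition boundary_space :: "'a set \<Rightarrow> 'a rel \<Rightarrow> (nat \<Rightarrow> 'a trace) measure" where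
  "boundary_space \<Sigma> I =
     sigma (boundary \<Sigma> I) (cylinder \<Sigma> I ` carrier (trace_monoid \<Sigma> I))"


section \<open>Partial actions\<close>

text \<open>\<open>E \<alpha>\<close> is the set of letters that may act on the state \<open>\<alpha>\<close>, and \<open>\<delta> \<alpha> a\<close> is the state
  \<open>\<alpha> \<cdot> a\<close>, which is meaningful only for \<open>a \<in> E \<alpha>\<close>.\<close>

locale partial_action = trace_alphabet \<Sigma> I
  for \<Sigma> :: "'a set" and I :: "'a rel" +
  fixes X :: "'s set" and E :: "'s \<Rightarrow> 'a set" and \<delta> :: "'s \<Rightarrow> 'a \<Rightarrow> 's"
  assumes enabled_nonempty: "\<alpha> \<in> X \<Longrightarrow> E \<alpha> \<noteq> {}"
    and enabled_subset: "\<alpha> \<in> X \<Longrightarrow> E \<alpha> \<subseteq> \<Sigma>"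
    and step_closed: "\<alpha> \<in> X \<Longrightarrow> a \<in> E \<alpha> \<Longrightarrow> \<delta> \<alpha> a \<in> X"
    and step_commute:
      "\<alpha> \<in> X \<Longrightarrow> a \<in> E \<alpha> \<Longrightarrow> b \<in> \<Sigma> \<Longrightarrow> clique_parallel \<Sigma> I (trace_of \<Sigma> I [a]) (trace_of \<Sigma> I [b]) \<Longrightarrow>
         b \<in> E \<alpha> \<and> a \<in> E (\<delta> \<alpha> b) \<and> b \<in> E (\<delta> \<alpha> a) \<and> \<delta> (\<delta> \<alpha> a) b = \<delta> (\<delta> \<alpha> b) a \<or>
         b \<notin> E \<alpha> \<and> b \<notin> E (\<delta> \<alpha> a)"

definition is_sub_action :: "'s set \<Rightarrow> ('s \<Rightarrow> 'a set) \<Rightarrow> ('s \<Rightarrow> 'a \<Rightarrow> 's) \<Rightarrow> 's set \<Rightarrow> bool" where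
  "is_sub_action X E \<delta> Y \<longleftrightarrow> Y \<noteq> {} \<and> Y \<subseteq> X \<and> (\<forall>\<alpha>\<in>Y. \<forall>a\<in>E \<alpha>. \<delta> \<alpha> a \<in> Y)"

definition irreducible_action :: "'s set \<Rightarrow> ('s \<Rightarrow> 'a set) \<Rightarrow> ('s \<Rightarrow> 'a \<Rightarrow> 's) \<Rightarrow> bool" where
  "irreducible_action X E \<delta> \<longleftrightarrow> (\<forall>Y. is_sub_action X E \<delta> Y \<longrightarrow> Y = X)"

text \<open>The associated total action on \<open>X \<union> {\<bottom>}\<close>, with \<open>\<bottom>\<close> represented by \<open>None\<close>. A trace acts
  through any of its representing words.\<close>

definition total_step ::
  "('s \<Rightarrow> 'a set) \<Rightarrow> ('s \<Rightarrow> 'a \<Rightarrow> 's) \<Rightarrow> 's option \<Rightarrow> 'a \<Rightarrow> 's option" where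
  "total_step E \<delta> s a =
     (case s of None \<Rightarrow> None | Some \<alpha> \<Rightarrow> if a \<in> E \<alpha> then Some (\<delta> \<alpha> a) else None)"

definition total_act ::
  "('s \<Rightarrow> 'a set) \<Rightarrow> ('s \<Rightarrow> 'a \<Rightarrow> 's) \<Rightarrow> 's option \<Rightarrow> 'a trace \<Rightarrow> 's option" where
  "total_act E \<delta> s x = the_elem (foldl (total_step E \<delta>) s ` x)"

definition admissible ::
  "'a set \<Rightarrow> 'a rel \<Rightarrow> ('s \<Rightarrow> 'a set) \<Rightarrow> ('s \<Rightarrow> 'a \<Rightarrow> 's) \<Rightarrow> 's \<Rightarrow> 'a trace set" where
  "admissible \<Sigma> I E \<delta> \<alpha> =
     {x \<in> carrier (trace_monoid \<Sigma> I). total_act E \<delta> (Some \<alpha>) x \<noteq> None}"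

text \<open>The state \<open>\<alpha> \<cdot> x\<close>, meaningful only for admissible \<open>x\<close>.\<close>

definition act :: "('s \<Rightarrow> 'a set) \<Rightarrow> ('s \<Rightarrow> 'a \<Rightarrow> 's) \<Rightarrow> 's \<Rightarrow> 'a trace \<Rightarrow> 's" where
  "act E \<delta> \<alpha> x = the (total_act E \<delta> (Some \<alpha>) x)"


section \<open>Growth series, characteristic root and Parry cocycle\<close>

definition growth_coeff ::
  "'a set \<Rightarrow> 'a rel \<Rightarrow> ('s \<Rightarrow> 'a set) \<Rightarrow> ('s \<Rightarrow> 'a \<Rightarrow> 's) \<Rightarrow> 's \<Rightarrow> nat \<Rightarrow> real" where
  "growth_coeff \<Sigma> I E \<delta> \<alpha> n = real (card {x \<in> admissible \<Sigma> I E \<delta> \<alpha>. trace_length x = n})"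

definition growth_series ::
  "'a set \<Rightarrow> 'a rel \<Rightarrow> ('s \<Rightarrow> 'a set) \<Rightarrow> ('s \<Rightarrow> 'a \<Rightarrow> 's) \<Rightarrow> 's \<Rightarrow> real \<Rightarrow> real" where
  "growth_series \<Sigma> I E \<delta> \<alpha> t = (\<Sum>\<^sub>\<infinity>x\<in>admissible \<Sigma> I E \<delta> \<alpha>. t ^ trace_length x)"

definition char_root ::
  "'a set \<Rightarrow> 'a rel \<Rightarrow> 's set \<Rightarrow> ('s \<Rightarrow> 'a set) \<Rightarrow> ('s \<Rightarrow> 'a \<Rightarrow> 's) \<Rightarrow> real" where
  "char_root \<Sigma> I X E \<delta> =
     (THE t. \<forall>\<alpha>\<in>X. conv_radius (growth_coeff \<Sigma> I E \<delta> \<alpha>) = ereal t)"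

definition parry_cocycle ::
  "'a set \<Rightarrow> 'a rel \<Rightarrow> 's set \<Rightarrow> ('s \<Rightarrow> 'a set) \<Rightarrow> ('s \<Rightarrow> 'a \<Rightarrow> 's) \<Rightarrow> 's \<Rightarrow> 's \<Rightarrow> real" where
  "parry_cocycle \<Sigma> I X E \<delta> \<alpha> \<beta> =
     Lim (at_left (char_root \<Sigma> I X E \<delta>))
       (\<lambda>t. growth_series \<Sigma> I E \<delta> \<beta> t / growth_series \<Sigma> I E \<delta> \<alpha> t)"


section \<open>Well-definedness\<close>

context trace_alphabet
begin

lemma trace_rel_lists: "(u, v) \<in> trace_rel \<Sigma> I \<Longrightarrow> u \<in> lists \<Sigma> \<and> v \<in> lists \<Sigma>"
  by (induction rule: trace_rel.induct) (use indep_subset in auto)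

lemma equiv_trace_rel: "equiv (lists \<Sigma>) (trace_rel \<Sigma> I)"
proof (rule equivI)
  show "trace_rel \<Sigma> I \<subseteq> lists \<Sigma> \<times> lists \<Sigma>"
    using trace_rel_lists by auto
  show "refl_on (lists \<Sigma>) (trace_rel \<Sigma> I)"
    by (intro refl_onI) (auto intro: trace_rel.refl)
  show "Relation.sym (trace_rel \<Sigma> I)"
    by (intro symI) (rule trace_rel.sym)
  show "Relation.trans (trace_rel \<Sigma> I)"
    by (intro transI) (rule trace_rel.trans)
qed

lemma trace_rel_length: "(u, v) \<in> trace_rel \<Sigma> I \<Longrightarrow> length u = length v"
  by (induction rule: trace_rel.induct) auto

lemma trace_rel_set: "(u, v) \<in> trace_rel \<Sigma> I \<Longrightarrow> set u = set v"
  by (induction rule: trace_rel.induct) auto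

lemma self_in_trace_of: "w \<in> lists \<Sigma> \<Longrightarrow> w \<in> trace_of \<Sigma> I w"
  by (simp add: trace_of_def trace_rel.refl)

lemma the_elem_trace_of:
  assumes "w \<in> lists \<Sigma>" "\<And>u v. (u, v) \<in> trace_rel \<Sigma> I \<Longrightarrow> f u = f v"
  shows "the_elem (f ` trace_of \<Sigma> I w) = f w"
proof -
  have "f ` trace_of \<Sigma> I w = {f w}"
  proof (intro equalityI subsetI)
    fix y assume "y \<in> f ` trace_of \<Sigma> I w"
    then obtain u where "(w, u) \<in> trace_rel \<Sigma> I" "y = f u"
      by (auto simp: trace_of_def)
    then show "y \<in> {f w}"
      using assms(2)[of w u] by simp
  qed (use self_in_trace_of[OF assms(1)] in blast)
  then show ?thesis by simp
qed

lemma trace_length_trace_of: "w \<in> lists \<Sigma> \<Longrightarrow> trace_length (trace_of \<Sigma> I w) = length w"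
  unfolding trace_length_def by (rule the_elem_trace_of) (auto dest: trace_rel_length)

lemma letters_trace_of: "w \<in> lists \<Sigma> \<Longrightarrow> letters (trace_of \<Sigma> I w) = set w"
proof -
  assume "w \<in> lists \<Sigma>"
  moreover have "set u = set w" if "u \<in> trace_of \<Sigma> I w" for u
    using that trace_rel_set[of w u] by (simp add: trace_of_def)
  ultimately show ?thesis
    using self_in_trace_of[of w] unfolding letters_def by blast
qed

lemma trace_of_eq_iff:
  "u \<in> lists \<Sigma> \<Longrightarrow> v \<in> lists \<Sigma> \<Longrightarrow> trace_of \<Sigma> I u = trace_of \<Sigma> I v \<longleftrightarrow> (u, v) \<in> trace_rel \<Sigma> I"
  unfolding trace_of_def by (rule eq_equiv_class_iff[OF equiv_trace_rel])

lemma carrier_trace_monoid: "carrier (trace_monoid \<Sigma> I) = trace_of \<Sigma> I ` lists \<Sigma>"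
  by (auto simp: trace_monoid_def trace_of_def quotient_def)

lemma mult_trace_of:
  assumes "u \<in> lists \<Sigma>" "v \<in> lists \<Sigma>"
  shows "trace_of \<Sigma> I u \<otimes>\<^bsub>trace_monoid \<Sigma> I\<^esub> trace_of \<Sigma> I v = trace_of \<Sigma> I (u @ v)"
proof -
  have *: "trace_of \<Sigma> I (u' @ v') = trace_of \<Sigma> I (u @ v)"
    if "u' \<in> trace_of \<Sigma> I u" "v' \<in> trace_of \<Sigma> I v" for u' v'
  proof -
    have "(u @ v, u' @ v') \<in> trace_rel \<Sigma> I"
      using that by (auto simp: trace_of_def intro: trace_rel.append)
    then show ?thesis
      using trace_rel_lists[of "u @ v" "u' @ v'"] trace_of_eq_iff[of "u @ v" "u' @ v'"] by simp
  qed
  show ?thesis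
    using * self_in_trace_of[OF assms(1)] self_in_trace_of[OF assms(2)]
    unfolding trace_monoid_def monoid.simps by blast
qed

lemma monoid_trace_monoid: "Group.monoid (trace_monoid \<Sigma> I)" (is "Group.monoid ?M")
proof -
  have one: "\<one>\<^bsub>?M\<^esub> = trace_of \<Sigma> I []"
    by (simp add: trace_monoid_def)
  have in_carrier: "trace_of \<Sigma> I w \<in> carrier ?M" if "w \<in> lists \<Sigma>" for w
    using that by (simp add: carrier_trace_monoid)
  have elim: "\<exists>w\<in>lists \<Sigma>. x = trace_of \<Sigma> I w" if "x \<in> carrier ?M" for x
    using that by (auto simp: carrier_trace_monoid)
  show ?thesis
  proof (rule Group.monoidI)
    fix x y z assume "x \<in> carrier ?M" "y \<in> carrier ?M" "z \<in> carrier ?M"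
    then obtain u v w where "u \<in> lists \<Sigma>" "v \<in> lists \<Sigma>" "w \<in> lists \<Sigma>"
      "x = trace_of \<Sigma> I u" "y = trace_of \<Sigma> I v" "z = trace_of \<Sigma> I w"
      using elim by metis
    then show "x \<otimes>\<^bsub>?M\<^esub> y \<otimes>\<^bsub>?M\<^esub> z = x \<otimes>\<^bsub>?M\<^esub> (y \<otimes>\<^bsub>?M\<^esub> z)"
      by (simp add: mult_trace_of)
  next
    fix x y assume "x \<in> carrier ?M" "y \<in> carrier ?M"
    then obtain u v where "u \<in> lists \<Sigma>" "v \<in> lists \<Sigma>"
      "x = trace_of \<Sigma> I u" "y = trace_of \<Sigma> I v"
      using elim by metis
    then show "x \<otimes>\<^bsub>?M\<^esub> y \<in> carrier ?M"
      using in_carrier[of "u @ v"] by (simp add: mult_trace_of)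
  next
    show "\<one>\<^bsub>?M\<^esub> \<in> carrier ?M"
      using in_carrier[of "[]"] one by simp
  next
    fix x assume "x \<in> carrier ?M"
    then obtain u where "u \<in> lists \<Sigma>" "x = trace_of \<Sigma> I u"
      using elim by metis
    then show "\<one>\<^bsub>?M\<^esub> \<otimes>\<^bsub>?M\<^esub> x = x" "x \<otimes>\<^bsub>?M\<^esub> \<one>\<^bsub>?M\<^esub> = x"
      by (simp_all add: one mult_trace_of)
  qed
qed

lemma parallel_letters_iff:
  assumes "a \<in> \<Sigma>" "b \<in> \<Sigma>"
  shows "clique_parallel \<Sigma> I (trace_of \<Sigma> I [a]) (trace_of \<Sigma> I [b]) \<longleftrightarrow> (a, b) \<in> I"
proof -
  have "(a, b) \<in> I" if "w \<in> lists \<Sigma>" "distinct w" "pairwise (\<lambda>a b. (a, b) \<in> I) (set w)"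
    "trace_of \<Sigma> I [a, b] = trace_of \<Sigma> I w" for w
  proof -
    have "([a, b], w) \<in> trace_rel \<Sigma> I"
      using that assms trace_of_eq_iff[of "[a, b]" w] by simp
    then have l: "length w = 2" and s: "set w = {a, b}"
      using trace_rel_length[of "[a, b]" w] trace_rel_set[of "[a, b]" w] by simp_all
    have "a \<noteq> b"
      using l s distinct_card[OF that(2)] by (cases "a = b") simp_all
    then show ?thesis
      using that(3) s by (auto simp: pairwise_def)
  qed
  moreover have "is_clique \<Sigma> I (trace_of \<Sigma> I [a, b])" if "(a, b) \<in> I"
    unfolding is_clique_def
    using that assms indep_sym indep_irrefl
    by (intro bexI[of _ "[a, b]"]) (auto simp: pairwise_def sym_def irrefl_def)
  ultimately show ?thesis
    using assms by (auto simp: clique_parallel_def mult_trace_of is_clique_def)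
qed

end

context partial_action
begin

lemma total_step_closed:
  "s \<in> insert None (Some ` X) \<Longrightarrow> total_step E \<delta> s a \<in> insert None (Some ` X)"
  using step_closed by (auto simp: total_step_def)

lemma foldl_total_step_closed:
  "s \<in> insert None (Some ` X) \<Longrightarrow> foldl (total_step E \<delta>) s w \<in> insert None (Some ` X)"
  by (induction w arbitrary: s) (simp_all only: foldl_Nil foldl_Cons total_step_closed)

lemma total_step_commute:
  assumes "s \<in> insert None (Some ` X)" "(a, b) \<in> I"
  shows "total_step E \<delta> (total_step E \<delta> s a) b = total_step E \<delta> (total_step E \<delta> s b) a"
proof -
  have "a \<in> \<Sigma>" "b \<in> \<Sigma>" "(b, a) \<in> I"
    using assms(2) indep_subset indep_sym by (auto simp: sym_def)
  then have p: "clique_parallel \<Sigma> I (trace_of \<Sigma> I [a]) (trace_of \<Sigma> I [b])"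
    "clique_parallel \<Sigma> I (trace_of \<Sigma> I [b]) (trace_of \<Sigma> I [a])"
    using assms(2) by (simp_all add: parallel_letters_iff)
  show ?thesis
  proof (cases s)
    case (Some \<alpha>)
    then have "\<alpha> \<in> X" using assms(1) by auto
    then show ?thesis
      using step_commute[OF \<open>\<alpha> \<in> X\<close> _ \<open>b \<in> \<Sigma>\<close> p(1)]
        step_commute[OF \<open>\<alpha> \<in> X\<close> _ \<open>a \<in> \<Sigma>\<close> p(2)] Some
      by (cases "a \<in> E \<alpha>"; cases "b \<in> E \<alpha>") (auto simp: total_step_def)
  qed (simp add: total_step_def)
qed

lemma foldl_total_step_trace_rel:
  assumes "(u, v) \<in> trace_rel \<Sigma> I" "s \<in> insert None (Some ` X)"
  shows "foldl (total_step E \<delta>) s u = foldl (total_step E \<delta>) s v"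
  using assms
proof (induction arbitrary: s rule: trace_rel.induct)
  case (commute a b)
  then show ?case using total_step_commute[of s a b] by (simp del: insert_iff)
next
  case (append u u' v v')
  have "foldl (total_step E \<delta>) s (u @ v) = foldl (total_step E \<delta>) (foldl (total_step E \<delta>) s u') v"
    using append.IH(1)[OF append.prems] by simp
  also have "\<dots> = foldl (total_step E \<delta>) s (u' @ v')"
    using append.IH(2)[OF foldl_total_step_closed[OF append.prems]] by simp
  finally show ?case .
next
  case (sym u v)
  then show ?case by metis
next
  case (trans u v w)
  then show ?case by metis
qed (rule HOL.refl)

lemma total_act_trace_of:
  "w \<in> lists \<Sigma> \<Longrightarrow> s \<in> insert None (Some ` X) \<Longrightarrow>
     total_act E \<delta> s (trace_of \<Sigma> I w) = foldl (total_step E \<delta>) s w"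
  unfolding total_act_def
  by (rule the_elem_trace_of) (assumption, rule foldl_total_step_trace_rel)

lemma total_act_mult:
  assumes "s \<in> insert None (Some ` X)"
    "x \<in> carrier (trace_monoid \<Sigma> I)" "y \<in> carrier (trace_monoid \<Sigma> I)"
  shows "total_act E \<delta> s (x \<otimes>\<^bsub>trace_monoid \<Sigma> I\<^esub> y) = total_act E \<delta> (total_act E \<delta> s x) y"
proof -
  obtain u v where "u \<in> lists \<Sigma>" "v \<in> lists \<Sigma>" "x = trace_of \<Sigma> I u" "y = trace_of \<Sigma> I v"
    using assms(2,3) unfolding carrier_trace_monoid by blast
  then show ?thesis
    using total_act_trace_of[OF \<open>u \<in> lists \<Sigma>\<close> assms(1)]
      total_act_trace_of[of "u @ v", OF _ assms(1)]
      total_act_trace_of[OF \<open>v \<in> lists \<Sigma>\<close> foldl_total_step_closed[OF assms(1), of u]]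
    by (simp add: mult_trace_of)
qed

end

end

(* Idea. Weight the admissible traces y of a state \<alpha> by t ^ |y| / Z_\<alpha>(t) and let t increase to t_0.
   Moebius inversion over cliques yields a linear system for the series Z_\<alpha> whose matrix is
   polynomial in t and the identity at t = 0, so the Z_\<alpha> are rational; irreducibility bounds their
   ratios, hence these have limits at t_0. Submultiplicativity of the total growth coefficients makes
   Z_\<alpha> diverge at t_0, so finite sets of traces carry no mass in the limit. The multiples of x
   have weight t ^ |x| Z_{\<alpha>x}(t) / Z_\<alpha>(t), which converges to t_0 ^ |x| \<Gamma>(\<alpha>, \<alpha>x). As divisibility by x
   depends only on the first height(x) cliques of the normal form, the limiting weights of the sets
   of traces with a given normal-form prefix exist; they are the finite-dimensional distributions of
   the measure on the boundary. *)

theory Submission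
  imports Defs
begin

text \<open>Traces with a common multiple share boundary points, so cylinders overlap and
  prescribing values on them does not by itself yield consistent weights. The sequences with a given
  beginning of fixed length do partition the boundary. Their weights are recovered from those of the
  multiples by a system that is triangular with respect to the length of the product of the cliques.
  Solving it formally would leave the sign of the solution open; obtaining it as a limit of weights
  of sets of traces makes it nonnegative at once. For t below t_0, consistency from one prefix
  length to the next fails by the weight of at most one trace, the product of the given cliques, and
  divergence of the series at t_0 removes this defect. Limits are taken separately on each set,
  without compactness, and no spectral theory enters: a bounded rational function has a one-sided
  limit whatever the order of the zero of its denominator. The sequence space construction then uses
  only nonnegativity, total mass 1 and consistency of the weights.\<close>

section \<open>Trace monoids\<close>

text \<open>\<open>minl I w\<close> consists of the letters of \<open>w\<close> that can be commuted to the front.\<close>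

fun minl :: "'a rel \<Rightarrow> 'a list \<Rightarrow> 'a set" where
  "minl I [] = {}"
| "minl I (b # w) = insert b {a \<in> minl I w. (a, b) \<in> I}"

lemma minl_append: "minl I (u @ v) = minl I u \<union> {a \<in> minl I v. \<forall>b\<in>set u. (a, b) \<in> I}"
  by (induction u) auto

lemma minl_subset: "minl I w \<subseteq> set w"
  by (induction w) auto

lemma minl_pairwise: "sym I \<Longrightarrow> pairwise (\<lambda>a b. (a, b) \<in> I) (minl I w)"
  by (induction w) (auto simp: pairwise_def dest: symD)

lemma minl_pairwise_eq:
  "pairwise (\<lambda>a b. (a, b) \<in> I) (set w) \<Longrightarrow> sym I \<Longrightarrow> minl I w = set w"
  by (induction w) (auto simp: pairwise_insert)

text \<open>Equivalent words have the same \<open>minl\<close> (\<open>minl_trace_rel\<close>), so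
  the image is a singleton and any representing word computes the value.\<close>

definition min_letters :: "'a rel \<Rightarrow> 'a trace \<Rightarrow> 'a set" where
  "min_letters I x = the_elem (minl I ` x)"

text \<open>Coding cliques by sets of letters turns sums over cliques into sums over subsets of
  \<Sigma>. The chosen enumeration is irrelevant for independent \<open>S\<close> inside \<Sigma>
  (\<open>cl_eq_tr\<close>); for other sets the value carries no meaning.\<close>

definition clique_of :: "'a set \<Rightarrow> 'a rel \<Rightarrow> 'a set \<Rightarrow> 'a trace" where
  "clique_of \<Sigma> I S = trace_of \<Sigma> I (SOME w. set w = S \<and> distinct w)"

definition is_normal :: "'a set \<Rightarrow> 'a rel \<Rightarrow> 'a trace list \<Rightarrow> bool" where
  "is_normal \<Sigma> I cs \<longleftrightarrow> set cs \<subseteq> nonempty_cliques \<Sigma> I \<and> successively (normal_arrow I) cs"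

context trace_alphabet
begin

abbreviation "M \<equiv> trace_monoid \<Sigma> I"
abbreviation "tr \<equiv> trace_of \<Sigma> I"
abbreviation "cl \<equiv> clique_of \<Sigma> I"
abbreviation "len \<equiv> trace_length"
abbreviation "mins \<equiv> min_letters I"
abbreviation "cprod \<equiv> trace_prod \<Sigma> I"
abbreviation "indep S \<equiv> pairwise (\<lambda>a b. (a, b) \<in> I) S"
abbreviation "nf \<equiv> normal_form \<Sigma> I"

sublocale M: Group.monoid "trace_monoid \<Sigma> I"
  by (rule monoid_trace_monoid)

lemma trace_cases:
  assumes "x \<in> carrier M" obtains w where "w \<in> lists \<Sigma>" "x = tr w"
  using assms by (auto simp: carrier_trace_monoid)

lemma tr_closed [simp]: "w \<in> lists \<Sigma> \<Longrightarrow> tr w \<in> carrier M"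
  by (simp add: carrier_trace_monoid)

lemma one_trace: "\<one>\<^bsub>M\<^esub> = tr []"
  by (simp add: trace_monoid_def)

lemma tr_Cons: "a \<in> \<Sigma> \<Longrightarrow> w \<in> lists \<Sigma> \<Longrightarrow> tr (a # w) = tr [a] \<otimes>\<^bsub>M\<^esub> tr w"
  by (simp add: mult_trace_of)

section \<open>Minimal letters and left cancellation\<close>

lemma minl_trace_rel: "(u, v) \<in> trace_rel \<Sigma> I \<Longrightarrow> minl I u = minl I v"
proof (induction rule: trace_rel.induct)
  case (commute a b)
  then show ?case using indep_sym by (auto dest: symD)
next
  case (append u u' v v')
  then show ?case using trace_rel_set[OF append.hyps(1)] by (simp add: minl_append)
qed auto

text \<open>The source of cancellation: deleting \<open>a\<close> from \<open>a # u\<close> and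
  \<open>a # v\<close> returns \<open>u\<close> and \<open>v\<close>. In the \<open>append\<close>
  case the equality of letter sets makes the deletion happen in the same factor on both
  sides.\<close>

lemma remove1_trace_rel:
  "(u, v) \<in> trace_rel \<Sigma> I \<Longrightarrow> (remove1 a u, remove1 a v) \<in> trace_rel \<Sigma> I"
proof (induction rule: trace_rel.induct)
  case (commute b c)
  then have "b \<noteq> c" "b \<in> \<Sigma>" "c \<in> \<Sigma>" using indep_irrefl indep_subset by (auto simp: irrefl_def)
  with commute show ?case by (auto intro: trace_rel.refl trace_rel.commute)
next
  case (refl w)
  then show ?case by (auto intro!: trace_rel.refl dest: notin_set_remove1 in_set_remove1[THEN iffD1] set_remove1_subset[THEN subsetD])
next
  case (append u u' v v')
  then show ?case using trace_rel_set[OF append.hyps(1)]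
    by (auto simp: remove1_append intro: trace_rel.append)
qed (auto intro: trace_rel.sym trace_rel.trans)

text \<open>All letters before the first occurrence of a minimal letter are independent of it, so
  this occurrence can be moved to the front, past one letter per induction step.\<close>

lemma minl_remove1:
  "w \<in> lists \<Sigma> \<Longrightarrow> a \<in> minl I w \<Longrightarrow> (w, a # remove1 a w) \<in> trace_rel \<Sigma> I"
proof (induction w)
  case (Cons b w)
  show ?case
  proof (cases "a = b")
    case False
    with Cons.prems have ab: "a \<in> minl I w" "(b, a) \<in> I" and w: "w \<in> lists \<Sigma>" "b \<in> \<Sigma>"
      using indep_sym by (auto dest: symD)
    have r: "remove1 a w \<in> lists \<Sigma>" using w by (auto dest: set_remove1_subset[THEN subsetD])
    have "([b] @ w, [b] @ (a # remove1 a w)) \<in> trace_rel \<Sigma> I"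
      using Cons.IH w ab by (intro trace_rel.append trace_rel.refl) auto
    moreover have "([b, a] @ remove1 a w, [a, b] @ remove1 a w) \<in> trace_rel \<Sigma> I"
      using ab r by (intro trace_rel.append trace_rel.refl trace_rel.commute) auto
    ultimately show ?thesis using False by (auto intro: trace_rel.trans)
  qed (use Cons.prems in \<open>simp add: trace_rel.refl\<close>)
qed simp

lemma mins_tr: "w \<in> lists \<Sigma> \<Longrightarrow> mins (tr w) = minl I w"
  unfolding min_letters_def by (rule the_elem_trace_of) (auto dest: minl_trace_rel)

lemma len_mult [simp]:
  "x \<in> carrier M \<Longrightarrow> y \<in> carrier M \<Longrightarrow> len (x \<otimes>\<^bsub>M\<^esub> y) = len x + len y"
  by (elim trace_cases) (simp add: mult_trace_of trace_length_trace_of)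

lemma len_one [simp]: "len \<one>\<^bsub>M\<^esub> = 0"
  by (simp add: one_trace trace_length_trace_of)

lemma tr_eq_one_iff: "w \<in> lists \<Sigma> \<Longrightarrow> tr w = \<one>\<^bsub>M\<^esub> \<longleftrightarrow> w = []"
  using trace_of_eq_iff[of w "[]"] trace_rel_length[of w "[]"] by (auto simp: one_trace)

lemma len_eq_0_iff: "x \<in> carrier M \<Longrightarrow> len x = 0 \<longleftrightarrow> x = \<one>\<^bsub>M\<^esub>"
  by (elim trace_cases) (simp add: tr_eq_one_iff trace_length_trace_of)

lemma letters_mult:
  "x \<in> carrier M \<Longrightarrow> y \<in> carrier M \<Longrightarrow> letters (x \<otimes>\<^bsub>M\<^esub> y) = letters x \<union> letters y"
  by (elim trace_cases) (simp add: mult_trace_of letters_trace_of)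

lemma letters_subset: "x \<in> carrier M \<Longrightarrow> letters x \<subseteq> \<Sigma>"
  by (elim trace_cases) (auto simp: letters_trace_of)

lemma mins_mult:
  "x \<in> carrier M \<Longrightarrow> y \<in> carrier M \<Longrightarrow>
    mins (x \<otimes>\<^bsub>M\<^esub> y) = mins x \<union> {a \<in> mins y. \<forall>b\<in>letters x. (a, b) \<in> I}"
  by (elim trace_cases) (simp add: mult_trace_of letters_trace_of mins_tr minl_append)

lemma mins_subset: "x \<in> carrier M \<Longrightarrow> mins x \<subseteq> letters x"
  by (elim trace_cases) (simp add: mins_tr letters_trace_of minl_subset)

lemma mins_indep: "x \<in> carrier M \<Longrightarrow> indep (mins x)"
  using indep_sym by (elim trace_cases) (simp add: mins_tr minl_pairwise)

lemma mins_one [simp]: "mins \<one>\<^bsub>M\<^esub> = {}"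
  by (simp add: one_trace mins_tr)

lemma mins_empty_iff: "x \<in> carrier M \<Longrightarrow> mins x = {} \<longleftrightarrow> x = \<one>\<^bsub>M\<^esub>"
proof (elim trace_cases)
  fix w assume "w \<in> lists \<Sigma>" "x = tr w"
  then show ?thesis
    using tr_eq_one_iff[of w] by (cases w) (auto simp: mins_tr)
qed

lemma cancel_letter:
  assumes "a \<in> \<Sigma>" "x \<in> carrier M" "y \<in> carrier M" "tr [a] \<otimes>\<^bsub>M\<^esub> x = tr [a] \<otimes>\<^bsub>M\<^esub> y"
  shows "x = y"
proof -
  obtain u v where uv: "u \<in> lists \<Sigma>" "x = tr u" "v \<in> lists \<Sigma>" "y = tr v"
    using assms(2,3) by (elim trace_cases)
  have "(a # u, a # v) \<in> trace_rel \<Sigma> I"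
    using assms uv by (simp add: mult_trace_of trace_of_eq_iff)
  then have "(u, v) \<in> trace_rel \<Sigma> I"
    using remove1_trace_rel[of "a # u" "a # v" a] by simp
  then show ?thesis using uv by (simp add: trace_of_eq_iff)
qed

lemma left_cancel:
  assumes "x \<in> carrier M" "y \<in> carrier M" "z \<in> carrier M" "x \<otimes>\<^bsub>M\<^esub> y = x \<otimes>\<^bsub>M\<^esub> z"
  shows "y = z"
proof -
  have "tr w \<otimes>\<^bsub>M\<^esub> y = tr w \<otimes>\<^bsub>M\<^esub> z \<Longrightarrow> y = z" if "w \<in> lists \<Sigma>" for w
    using that
  proof (induction w)
    case Nil
    then show ?case using assms by (simp flip: one_trace)
  next
    case (Cons a w)
    then have a: "a \<in> \<Sigma>" "w \<in> lists \<Sigma>" by auto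
    have *: "tr [a] \<otimes>\<^bsub>M\<^esub> (tr w \<otimes>\<^bsub>M\<^esub> y) = tr [a] \<otimes>\<^bsub>M\<^esub> (tr w \<otimes>\<^bsub>M\<^esub> z)"
      using Cons.prems a assms by (simp add: tr_Cons[OF a] M.m_assoc)
    have "tr w \<otimes>\<^bsub>M\<^esub> y = tr w \<otimes>\<^bsub>M\<^esub> z"
      using cancel_letter[OF a(1) _ _ *] a(2) assms(2,3) by simp
    then show ?case using Cons.IH a by blast
  qed
  note * = this
  obtain w where "w \<in> lists \<Sigma>" "x = tr w" using assms(1) by (elim trace_cases)
  then show ?thesis using * assms(4) by simp
qed

lemma letter_divides:
  assumes "x \<in> carrier M" "a \<in> mins x"
  shows "a \<in> \<Sigma>" "\<exists>y\<in>carrier M. x = tr [a] \<otimes>\<^bsub>M\<^esub> y"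
proof -
  obtain w where w: "w \<in> lists \<Sigma>" "x = tr w" using assms(1) by (elim trace_cases)
  show a: "a \<in> \<Sigma>" using assms mins_subset letters_subset by blast
  have r: "remove1 a w \<in> lists \<Sigma>" using w by (auto dest: set_remove1_subset[THEN subsetD])
  have "(w, a # remove1 a w) \<in> trace_rel \<Sigma> I"
    using minl_remove1[of w a] w assms by (simp add: mins_tr)
  then have "x = tr [a] \<otimes>\<^bsub>M\<^esub> tr (remove1 a w)"
    using w r a by (simp add: mult_trace_of trace_of_eq_iff)
  then show "\<exists>y\<in>carrier M. x = tr [a] \<otimes>\<^bsub>M\<^esub> y" using tr_closed[OF r] by blast
qed

section \<open>Cliques as independent sets of letters\<close>

lemma indep_words_rel:
  assumes "u \<in> lists \<Sigma>" "distinct u" "distinct v" "set u = set v" "indep (set u)"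
  shows "(u, v) \<in> trace_rel \<Sigma> I"
  using assms
proof (induction u arbitrary: v rule: list.induct)
  case (Cons a u)
  have sv: "set v = insert a (set u)" using \<open>set (a # u) = set v\<close> by simp
  have au: "a \<in> \<Sigma>" "u \<in> lists \<Sigma>" using Cons.prems(1) by simp_all
  have v: "v \<in> lists \<Sigma>" using au sv by (simp add: in_lists_conv_set)
  \<comment> \<open>In an independent word every letter is minimal, so the first letter of
    \<open>u\<close> can be pulled to the front of \<open>v\<close>; the tails are compared by
    induction.\<close>
  have "minl I v = set v"
    using sv \<open>indep (set (a # u))\<close> indep_sym by (intro minl_pairwise_eq) simp_all
  then have "a \<in> minl I v" using sv by simp
  then have 1: "(v, a # remove1 a v) \<in> trace_rel \<Sigma> I" using v by (intro minl_remove1)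
  have "set u = set (remove1 a v)" using sv \<open>distinct (a # u)\<close> \<open>distinct v\<close> by simp
  moreover have "indep (set u)" using \<open>indep (set (a # u))\<close> by (simp add: pairwise_insert)
  ultimately have "(u, remove1 a v) \<in> trace_rel \<Sigma> I"
    using \<open>distinct (a # u)\<close> \<open>distinct v\<close> Cons.IH[OF au(2)] by simp
  then have "([a] @ u, [a] @ remove1 a v) \<in> trace_rel \<Sigma> I"
    using au by (intro trace_rel.append trace_rel.refl) simp_all
  with 1 show ?case by (auto intro: trace_rel.trans trace_rel.sym)
qed (auto intro: trace_rel.refl)

lemma cl_eq_tr:
  assumes "w \<in> lists \<Sigma>" "distinct w" "indep (set w)"
  shows "cl (set w) = tr w"
proof -
  define v where "v = (SOME v. set v = set w \<and> distinct v)"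
  have v: "set v = set w \<and> distinct v"
    unfolding v_def by (rule someI[of "\<lambda>v. set v = set w \<and> distinct v" w]) (use assms in simp)
  then have "v \<in> lists \<Sigma>"
    using assms(1) by (simp add: in_lists_conv_set)
  moreover have "(w, v) \<in> trace_rel \<Sigma> I"
    using v assms by (intro indep_words_rel) auto
  ultimately show ?thesis
    using trace_of_eq_iff[OF assms(1), of v] by (simp add: clique_of_def v_def)
qed

lemma indep_set_word:
  assumes "S \<subseteq> \<Sigma>"
  obtains w where "w \<in> lists \<Sigma>" "distinct w" "set w = S"
proof -
  obtain w where "set w = S" "distinct w"
    using finite_distinct_list[of S] finite_subset[OF assms finite_alphabet] by blast
  with assms show ?thesis by (intro that[of w]) auto
qed

lemma cl_props:
  assumes "S \<subseteq> \<Sigma>" "indep S"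
  shows cl_clique: "is_clique \<Sigma> I (cl S)" and cl_closed: "cl S \<in> carrier M"
    and letters_cl: "letters (cl S) = S" and len_cl: "len (cl S) = card S"
    and mins_cl: "mins (cl S) = S"
proof -
  obtain w where w: "w \<in> lists \<Sigma>" "distinct w" "set w = S" using assms by (auto elim: indep_set_word)
  then have e: "cl S = tr w" using cl_eq_tr[of w] assms by simp
  show "is_clique \<Sigma> I (cl S)" using w assms e by (auto simp: is_clique_def)
  show "cl S \<in> carrier M" using w e by simp
  show "letters (cl S) = S" using w e by (simp add: letters_trace_of)
  show "len (cl S) = card S" using w e by (auto simp: trace_length_trace_of distinct_card)
  show "mins (cl S) = S" using w e minl_pairwise_eq[where I = I and w = w] assms(2) indep_sym by (metis mins_tr)
qed

lemma clique_props:
  assumes "is_clique \<Sigma> I c"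
  shows clique_closed: "c \<in> carrier M"
    and clique_eq: "c = cl (letters c)" and mins_clique: "mins c = letters c"
proof -
  obtain w where w: "w \<in> lists \<Sigma>" "distinct w" "indep (set w)" "c = tr w"
    using assms unfolding is_clique_def by blast
  have l: "letters c = set w" using w by (simp add: letters_trace_of)
  show "c \<in> carrier M" using w by simp
  show "c = cl (letters c)" using cl_eq_tr[of w] w l by metis
  show "mins c = letters c" using l w minl_pairwise_eq[OF w(3) indep_sym] by (simp add: mins_tr)
qed

lemma cl_empty: "cl {} = \<one>\<^bsub>M\<^esub>"
  using cl_eq_tr[of "[]"] by (simp add: one_trace)

lemma nonempty_cliquesD:
  assumes "c \<in> nonempty_cliques \<Sigma> I"
  shows "is_clique \<Sigma> I c" "c \<in> carrier M" "letters c \<noteq> {}"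
proof -
  show *: "is_clique \<Sigma> I c" using assms by (simp add: nonempty_cliques_def)
  then show "c \<in> carrier M" by (rule clique_closed)
  have "c \<noteq> \<one>\<^bsub>M\<^esub>" using assms by (simp add: nonempty_cliques_def)
  then show "letters c \<noteq> {}" using clique_eq[OF *] cl_empty by metis
qed

lemma finite_nonempty_cliques: "finite (nonempty_cliques \<Sigma> I)"
proof (rule finite_subset)
  show "nonempty_cliques \<Sigma> I \<subseteq> cl ` Pow \<Sigma>"
  proof
    fix c assume "c \<in> nonempty_cliques \<Sigma> I"
    then show "c \<in> cl ` Pow \<Sigma>"
      using nonempty_cliquesD(1,2)[of c] clique_eq[of c] letters_subset[of c] by blast
  qed
qed (use finite_alphabet in simp)

lemma divides_mins:
  assumes "x divides\<^bsub>M\<^esub> y" "x \<in> carrier M" "y \<in> carrier M" shows "mins x \<subseteq> mins y"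
proof -
  obtain z where "z \<in> carrier M" "y = x \<otimes>\<^bsub>M\<^esub> z" using assms(1) by (auto simp: factor_def)
  then show ?thesis using assms(2) by (simp add: mins_mult)
qed

lemma dividesI: "z \<in> carrier M \<Longrightarrow> y = x \<otimes>\<^bsub>M\<^esub> z \<Longrightarrow> x divides\<^bsub>M\<^esub> y"
  unfolding factor_def by blast

lemma dividesE:
  assumes "x divides\<^bsub>M\<^esub> y" obtains z where "z \<in> carrier M" "y = x \<otimes>\<^bsub>M\<^esub> z"
  using assms unfolding factor_def by blast

text \<open>The letters of \<open>S\<close> are extracted one at a time. By \<open>mins_mult\<close>
  a minimal letter of \<open>x\<close> other than the extracted \<open>a\<close> is minimal in the
  quotient, so the remaining letters stay available.\<close>

lemma cl_divides:
  assumes "x \<in> carrier M" "S \<subseteq> mins x"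
  shows "cl S divides\<^bsub>M\<^esub> x"
proof -
  have "tr w divides\<^bsub>M\<^esub> x" if "distinct w" "set w \<subseteq> mins x" "x \<in> carrier M" for w x
    using that
  proof (induction w arbitrary: x)
    case Nil
    then show ?case by (intro dividesI[of x]) (simp_all flip: one_trace)
  next
    case (Cons a w)
    then have "a \<in> mins x" by simp
    then obtain y where y: "a \<in> \<Sigma>" "y \<in> carrier M" "x = tr [a] \<otimes>\<^bsub>M\<^esub> y"
      using letter_divides[of x a] Cons.prems(3) by blast
    have "mins x = {a} \<union> {b \<in> mins y. (b, a) \<in> I}"
      using y by (simp add: mins_mult letters_trace_of mins_tr)
    then have "set w \<subseteq> mins y" using Cons.prems by auto
    then have "tr w divides\<^bsub>M\<^esub> y" using Cons y by auto
    then obtain z where z: "z \<in> carrier M" "y = tr w \<otimes>\<^bsub>M\<^esub> z"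
      by (rule dividesE)
    have w: "w \<in> lists \<Sigma>"
      using \<open>set w \<subseteq> mins y\<close> y mins_subset[of y] letters_subset[of y] by auto
    have "x = tr (a # w) \<otimes>\<^bsub>M\<^esub> z" using y z w tr_Cons[of a w] by (simp add: M.m_assoc)
    then show ?case using z(1) by (intro dividesI)
  qed
  note * = this
  have S: "S \<subseteq> \<Sigma>" using assms mins_subset[of x] letters_subset[of x] by auto
  then obtain w where w: "w \<in> lists \<Sigma>" "distinct w" "set w = S" by (rule indep_set_word)
  have "indep S" using mins_indep[OF assms(1)] assms(2) by (rule pairwise_subset)
  then show ?thesis using cl_eq_tr[of w] *[of w x] assms w by simp
qed

lemma cl_divides_iff:
  assumes "x \<in> carrier M" "S \<subseteq> \<Sigma>" "indep S"
  shows "cl S divides\<^bsub>M\<^esub> x \<longleftrightarrow> S \<subseteq> mins x"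
  using divides_mins[of "cl S" x] cl_divides[of x S] assms by (auto simp: mins_cl cl_closed)

section \<open>Cartier-Foata normal forms and divisibility\<close>

lemma normal_Nil [simp]: "is_normal \<Sigma> I []"
  by (simp add: is_normal_def)

lemma normal_Cons:
  "is_normal \<Sigma> I (c # cs) \<longleftrightarrow>
    c \<in> nonempty_cliques \<Sigma> I \<and> is_normal \<Sigma> I cs \<and> (cs \<noteq> [] \<longrightarrow> normal_arrow I c (hd cs))"
  by (auto simp: is_normal_def successively_Cons)

lemma normal_append:
  "is_normal \<Sigma> I (cs @ ds) \<longleftrightarrow> is_normal \<Sigma> I cs \<and> is_normal \<Sigma> I ds \<and>
     (cs \<noteq> [] \<longrightarrow> ds \<noteq> [] \<longrightarrow> normal_arrow I (last cs) (hd ds))"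
  by (auto simp: is_normal_def successively_append_iff)

lemma normal_take: "is_normal \<Sigma> I cs \<Longrightarrow> is_normal \<Sigma> I (take n cs)"
  using normal_append[of "take n cs" "drop n cs"] by simp

lemma cprod_Nil [simp]: "cprod [] = \<one>\<^bsub>M\<^esub>"
  and cprod_Cons [simp]: "cprod (c # cs) = c \<otimes>\<^bsub>M\<^esub> cprod cs"
  by (simp_all add: trace_prod_def)

lemma cprod_closed: "set cs \<subseteq> carrier M \<Longrightarrow> cprod cs \<in> carrier M"
  by (induction cs) auto

lemma normal_closed: "is_normal \<Sigma> I cs \<Longrightarrow> set cs \<subseteq> carrier M"
  using nonempty_cliquesD(2) by (auto simp: is_normal_def)

lemma normal_cprod_closed: "is_normal \<Sigma> I cs \<Longrightarrow> cprod cs \<in> carrier M"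
  by (intro cprod_closed normal_closed)

lemma cprod_append:
  "set cs \<subseteq> carrier M \<Longrightarrow> set ds \<subseteq> carrier M \<Longrightarrow> cprod (cs @ ds) = cprod cs \<otimes>\<^bsub>M\<^esub> cprod ds"
  by (induction cs) (auto simp: cprod_closed M.m_assoc)

text \<open>The arrow condition says that no letter of the next clique is independent of the whole
  preceding one, so nothing behind the head can reach the front.\<close>

lemma mins_cprod:
  "is_normal \<Sigma> I cs \<Longrightarrow> cs \<noteq> [] \<Longrightarrow> mins (cprod cs) = letters (hd cs)"
proof (induction cs)
  case (Cons c cs)
  then have c: "is_clique \<Sigma> I c" "c \<in> carrier M" "is_normal \<Sigma> I cs"
    using nonempty_cliquesD by (auto simp: normal_Cons)
  have "{a \<in> mins (cprod cs). \<forall>b\<in>letters c. (a, b) \<in> I} = {}"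
  proof (cases "cs = []")
    case False
    then have "mins (cprod cs) = letters (hd cs)" "normal_arrow I c (hd cs)"
      using Cons by (auto simp: normal_Cons)
    then show ?thesis using indep_sym unfolding normal_arrow_def by (blast dest: symD)
  qed simp
  then show ?case using c by (auto simp: mins_mult normal_cprod_closed mins_clique)
qed simp

text \<open>The first clique is determined by the product, as the clique of its minimal letters
  (\<open>mins_cprod\<close>); it is cancelled and the rest follows by induction.\<close>

lemma normal_unique:
  "is_normal \<Sigma> I cs \<Longrightarrow> is_normal \<Sigma> I ds \<Longrightarrow> cprod cs = cprod ds \<Longrightarrow> cs = ds"
proof (induction cs arbitrary: ds)
  case Nil
  have "mins (cprod ds) = {}" using Nil(3) mins_one by simp
  then have "letters (hd ds) = {}" if "ds \<noteq> []"
    using mins_cprod[OF Nil(2) that] by simp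
  then show ?case
    using nonempty_cliquesD(3)[of "hd ds"] Nil(2) by (cases ds) (simp_all add: normal_Cons)
next
  case (Cons c cs)
  have m: "mins (cprod (c # cs)) = letters c" "letters c \<noteq> {}"
    using Cons.prems(1) mins_cprod[of "c # cs"] nonempty_cliquesD(3)[of c]
    by (simp_all add: normal_Cons)
  have "ds \<noteq> []" using m Cons.prems(3) by (metis cprod_Nil mins_one)
  then obtain d ds' where ds: "ds = d # ds'" by (cases ds) simp_all
  have n: "c \<in> nonempty_cliques \<Sigma> I" "is_normal \<Sigma> I cs" "d \<in> nonempty_cliques \<Sigma> I" "is_normal \<Sigma> I ds'"
    using Cons.prems(1,2) ds by (simp_all add: normal_Cons)
  have "letters d = letters c"
    using m(1) mins_cprod[OF Cons.prems(2) \<open>ds \<noteq> []\<close>] Cons.prems(3) ds by simp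
  then have "d = c"
    using clique_eq[OF nonempty_cliquesD(1)] n(1,3) by metis
  moreover have "cprod cs = cprod ds'"
    using Cons.prems(3) unfolding ds \<open>d = c\<close> cprod_Cons
    by (rule left_cancel[rotated -1]) (use n nonempty_cliquesD(2) normal_cprod_closed in simp_all)
  ultimately show ?case using Cons.IH[OF n(2,4)] ds by simp
qed

text \<open>Greedy construction: split off the clique of all minimal letters and continue with the
  shorter quotient.\<close>

lemma normal_exists:
  assumes "x \<in> carrier M"
  shows "\<exists>cs. is_normal \<Sigma> I cs \<and> cprod cs = x"
  using assms
proof (induction "len x" arbitrary: x rule: less_induct)
  case less
  show ?case
  proof (cases "x = \<one>\<^bsub>M\<^esub>")
    case True
    then show ?thesis by (intro exI[of _ "[]"]) simp
  next
    case False
    let ?S = "mins x"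
    have S: "?S \<noteq> {}" "?S \<subseteq> \<Sigma>" "indep ?S"
      using less.prems False mins_empty_iff mins_subset letters_subset mins_indep by blast+
    obtain z where z: "z \<in> carrier M" "x = cl ?S \<otimes>\<^bsub>M\<^esub> z"
      using cl_divides[OF less.prems order_refl] by (rule dividesE)
    have "len x = card ?S + len z" using z S len_mult[of "cl ?S" z] cl_closed len_cl by simp
    moreover have "card ?S > 0" using S finite_subset[OF _ finite_alphabet] by (auto simp: card_gt_0_iff)
    ultimately have "len z < len x" by linarith
    then obtain cs where cs: "is_normal \<Sigma> I cs" "cprod cs = z" using less.hyps z by blast
    have "cl ?S \<in> nonempty_cliques \<Sigma> I"
      using S cl_clique mins_cl[OF S(2,3)] by (auto simp: nonempty_cliques_def)
    moreover have "normal_arrow I (cl ?S) (hd cs)" if "cs \<noteq> []"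
      unfolding normal_arrow_def
    proof
      fix b assume "b \<in> letters (hd cs)"
      then have b: "b \<in> mins z" using mins_cprod cs that by auto
      \<comment> \<open>A minimal letter \<open>b\<close> of the quotient that commutes with all of
        \<open>?S\<close> would be minimal in \<open>x\<close>, hence lie in \<open>?S\<close> and
        be independent of itself.\<close>
      show "\<exists>a\<in>letters (cl ?S). (a, b) \<notin> I"
      proof (rule ccontr)
        assume "\<not> ?thesis"
        then have i: "\<forall>a\<in>?S. (b, a) \<in> I" using letters_cl S indep_sym by (auto dest: symD)
        have "mins x = ?S \<union> {a \<in> mins z. \<forall>b\<in>?S. (a, b) \<in> I}"
          using z mins_mult[of "cl ?S" z] S cl_closed mins_cl letters_cl by simp
        then have "b \<in> ?S" using b i by blast
        then show False using i indep_irrefl by (auto simp: irrefl_def)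
      qed
    qed
    ultimately show ?thesis using cs z by (intro exI[of _ "cl ?S # cs"]) (auto simp: normal_Cons)
  qed
qed

lemma nf_props:
  assumes "x \<in> carrier M"
  shows normal_nf: "is_normal \<Sigma> I (nf x)" and cprod_nf: "cprod (nf x) = x"
proof -
  have "\<exists>!cs. is_normal \<Sigma> I cs \<and> cprod cs = x"
    using normal_exists[OF assms] normal_unique by blast
  from theI'[OF this] show "is_normal \<Sigma> I (nf x)" "cprod (nf x) = x"
    by (simp_all add: normal_form_def is_normal_def)
qed

lemma nf_cprod: "is_normal \<Sigma> I cs \<Longrightarrow> nf (cprod cs) = cs"
  by (intro normal_unique normal_nf cprod_nf normal_cprod_closed)

text \<open>The factor \<open>f\<close> makes the induction work: after a clique \<open>d\<close> is removed from \<open>f c\<^sub>1\<close>, the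
  remainder of \<open>f c\<^sub>1\<close> becomes the new \<open>f\<close>.\<close>

lemma divides_cprod_take:
  assumes "f \<in> carrier M" "is_normal \<Sigma> I cs" "\<forall>d\<in>set ds. is_clique \<Sigma> I d"
    "cprod ds divides\<^bsub>M\<^esub> f \<otimes>\<^bsub>M\<^esub> cprod cs"
  shows "cprod ds divides\<^bsub>M\<^esub> f \<otimes>\<^bsub>M\<^esub> cprod (take (length ds) cs)"
  using assms
proof (induction ds arbitrary: f cs)
  case Nil
  then show ?case
    by (intro dividesI[of "f \<otimes>\<^bsub>M\<^esub> cprod (take (length []) cs)"]) simp_all
next
  case (Cons d ds)
  show ?case
  proof (cases cs)
    case Nil
    then show ?thesis using Cons.prems by simp
  next
    case (Cons c cs')
    note prems = Cons.prems[unfolded Cons]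
    have c: "c \<in> carrier M" "is_clique \<Sigma> I c" "is_normal \<Sigma> I cs'" "cprod cs' \<in> carrier M"
      using prems(2) nonempty_cliquesD normal_cprod_closed by (auto simp: normal_Cons)
    have d: "d \<in> carrier M" "is_clique \<Sigma> I d" "cprod ds \<in> carrier M"
      using prems(3) clique_closed by (auto intro!: cprod_closed)
    obtain z where z: "z \<in> carrier M" "f \<otimes>\<^bsub>M\<^esub> (c \<otimes>\<^bsub>M\<^esub> cprod cs') = d \<otimes>\<^bsub>M\<^esub> cprod ds \<otimes>\<^bsub>M\<^esub> z"
      using prems(4) unfolding cprod_Cons by (rule dividesE)
    \<comment> \<open>The letters of \<open>d\<close> are minimal in the whole product. The arrow
      from \<open>c\<close> to the next clique keeps the letters behind \<open>c\<close> from
      reaching the front, so \<open>d\<close> already divides the product of \<open>f\<close> and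
      \<open>c\<close>.\<close>
    have "letters d \<subseteq> mins (d \<otimes>\<^bsub>M\<^esub> (cprod ds \<otimes>\<^bsub>M\<^esub> z))"
      using d z by (simp add: mins_mult mins_clique)
    also have "\<dots> = mins (f \<otimes>\<^bsub>M\<^esub> c \<otimes>\<^bsub>M\<^esub> cprod cs')"
      using z d c prems(1) by (simp add: M.m_assoc)
    also have "\<dots> \<subseteq> mins (f \<otimes>\<^bsub>M\<^esub> c)"
    proof (cases "cs' = []")
      case False
      then have "mins (cprod cs') = letters (hd cs')" "normal_arrow I c (hd cs')"
        using mins_cprod prems(2) by (auto simp: normal_Cons)
      then have "{a \<in> mins (cprod cs'). \<forall>b\<in>letters (f \<otimes>\<^bsub>M\<^esub> c). (a, b) \<in> I} = {}"
        using c prems(1) indep_sym unfolding normal_arrow_def by (simp add: letters_mult) (blast dest: symD)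
      moreover have "mins (f \<otimes>\<^bsub>M\<^esub> c \<otimes>\<^bsub>M\<^esub> cprod cs') = mins (f \<otimes>\<^bsub>M\<^esub> c) \<union>
          {a \<in> mins (cprod cs'). \<forall>b\<in>letters (f \<otimes>\<^bsub>M\<^esub> c). (a, b) \<in> I}"
        using c prems(1) by (intro mins_mult) simp_all
      ultimately show ?thesis by (metis Un_empty_right order_refl)
    qed (use prems c in simp)
    finally have "cl (letters d) divides\<^bsub>M\<^esub> f \<otimes>\<^bsub>M\<^esub> c" using prems(1) c by (intro cl_divides) auto
    then have "d divides\<^bsub>M\<^esub> f \<otimes>\<^bsub>M\<^esub> c" unfolding clique_eq[OF d(2), symmetric] .
    then obtain g where g: "g \<in> carrier M" "f \<otimes>\<^bsub>M\<^esub> c = d \<otimes>\<^bsub>M\<^esub> g"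
      by (rule dividesE)
    \<comment> \<open>Cancelling \<open>d\<close> leaves the same divisibility problem for
      \<open>ds\<close>, with \<open>g\<close> in place of \<open>f\<close> and \<open>cs'\<close>
      in place of \<open>cs\<close>; one clique is spent on each side.\<close>
    have "d \<otimes>\<^bsub>M\<^esub> (g \<otimes>\<^bsub>M\<^esub> cprod cs') = f \<otimes>\<^bsub>M\<^esub> c \<otimes>\<^bsub>M\<^esub> cprod cs'"
      using g c(4) d(1) by (simp add: M.m_assoc)
    also have "\<dots> = f \<otimes>\<^bsub>M\<^esub> (c \<otimes>\<^bsub>M\<^esub> cprod cs')"
      using prems(1) c by (intro M.m_assoc)
    also have "\<dots> = d \<otimes>\<^bsub>M\<^esub> (cprod ds \<otimes>\<^bsub>M\<^esub> z)"
      unfolding z(2) using d z(1) by (intro M.m_assoc)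
    finally have "g \<otimes>\<^bsub>M\<^esub> cprod cs' = cprod ds \<otimes>\<^bsub>M\<^esub> z"
      by (rule left_cancel[rotated -1]) (use g(1) c d z(1) in simp_all)
    then have "cprod ds divides\<^bsub>M\<^esub> g \<otimes>\<^bsub>M\<^esub> cprod (take (length ds) cs')"
      using g(1) c(3) prems(3) dividesI[OF z(1)] by (intro Cons.IH) simp_all
    then obtain y where y: "y \<in> carrier M" "g \<otimes>\<^bsub>M\<^esub> cprod (take (length ds) cs') = cprod ds \<otimes>\<^bsub>M\<^esub> y"
      by (rule dividesE)
    have t: "cprod (take (length ds) cs') \<in> carrier M"
      using normal_cprod_closed normal_take c(3) by blast
    have "f \<otimes>\<^bsub>M\<^esub> (c \<otimes>\<^bsub>M\<^esub> cprod (take (length ds) cs')) = f \<otimes>\<^bsub>M\<^esub> c \<otimes>\<^bsub>M\<^esub> cprod (take (length ds) cs')"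
      using prems(1) c t by (simp add: M.m_assoc)
    also have "\<dots> = d \<otimes>\<^bsub>M\<^esub> cprod ds \<otimes>\<^bsub>M\<^esub> y" using g y d t by (simp add: M.m_assoc)
    finally show ?thesis using y(1) Cons by (intro dividesI) simp_all
  qed
qed

text \<open>The forward direction is \<open>divides_cprod_take\<close> with trivial \<open>f\<close>
  and with \<open>nf x\<close> as \<open>ds\<close>; conversely \<open>y\<close> is a multiple of
  its own truncation. This matches divisibility of traces with \<open>cylinder\<close>, which
  inspects the same number of cliques.\<close>

lemma divides_iff_take_nf:
  assumes "x \<in> carrier M" "y \<in> carrier M"
  shows "x divides\<^bsub>M\<^esub> y \<longleftrightarrow> x divides\<^bsub>M\<^esub> cprod (take (height \<Sigma> I x) (nf y))"
proof
  have "\<forall>d\<in>set (nf x). is_clique \<Sigma> I d"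
    using normal_nf[OF assms(1)] nonempty_cliquesD(1) by (auto simp: is_normal_def)
  note * = divides_cprod_take[OF M.one_closed normal_nf[OF assms(2)] this]
  have t: "cprod (take (height \<Sigma> I x) (nf y)) \<in> carrier M"
    by (intro normal_cprod_closed normal_take normal_nf assms)
  show "x divides\<^bsub>M\<^esub> cprod (take (height \<Sigma> I x) (nf y))" if "x divides\<^bsub>M\<^esub> y"
    using * that unfolding Defs.height_def[symmetric] cprod_nf[OF assms(1)] cprod_nf[OF assms(2)]
      M.l_one[OF t] M.l_one[OF assms(2)] .
  let ?n = "height \<Sigma> I x"
  assume "x divides\<^bsub>M\<^esub> cprod (take ?n (nf y))"
  then obtain z where z: "z \<in> carrier M" "cprod (take ?n (nf y)) = x \<otimes>\<^bsub>M\<^esub> z"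
    by (rule dividesE)
  have n: "is_normal \<Sigma> I (take ?n (nf y) @ drop ?n (nf y))" using nf_props assms by simp
  then have d: "is_normal \<Sigma> I (take ?n (nf y))" "is_normal \<Sigma> I (drop ?n (nf y))"
    unfolding normal_append by auto
  have "y = cprod (take ?n (nf y) @ drop ?n (nf y))" using nf_props assms by simp
  also have "\<dots> = cprod (take ?n (nf y)) \<otimes>\<^bsub>M\<^esub> cprod (drop ?n (nf y))"
    using d by (intro cprod_append normal_closed)
  also have "\<dots> = x \<otimes>\<^bsub>M\<^esub> (z \<otimes>\<^bsub>M\<^esub> cprod (drop ?n (nf y)))"
    using z d normal_cprod_closed assms by (simp add: M.m_assoc)
  finally have "y = x \<otimes>\<^bsub>M\<^esub> (z \<otimes>\<^bsub>M\<^esub> cprod (drop ?n (nf y)))" .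
  then show "x divides\<^bsub>M\<^esub> y"
    by (rule dividesI[rotated]) (use z(1) d normal_cprod_closed in simp)
qed

end

section \<open>Irreducible partial actions\<close>

locale irreducible_partial_action = partial_action \<Sigma> I X E \<delta>
  for \<Sigma> :: "'a set" and I :: "'a rel" and X :: "'s set" and E :: "'s \<Rightarrow> 'a set"
    and \<delta> :: "'s \<Rightarrow> 'a \<Rightarrow> 's" +
  assumes finite_states: "finite X"
    and irreducible: "irreducible_action X E \<delta>"
begin

abbreviation "adm \<equiv> admissible \<Sigma> I E \<delta>"
abbreviation "st \<equiv> act E \<delta>"
abbreviation "coef \<equiv> growth_coeff \<Sigma> I E \<delta>"
abbreviation "Z \<equiv> growth_series \<Sigma> I E \<delta>"
abbreviation "t\<^sub>0 \<equiv> char_root \<Sigma> I X E \<delta>"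

section \<open>The action of traces on states\<close>

lemma adm_carrier: "x \<in> adm \<alpha> \<Longrightarrow> x \<in> carrier M"
  by (simp add: admissible_def)

lemma total_act_closed:
  assumes "\<alpha> \<in> X" "x \<in> carrier M"
  shows "total_act E \<delta> (Some \<alpha>) x \<in> insert None (Some ` X)"
proof -
  obtain w where w: "w \<in> lists \<Sigma>" "x = tr w" using assms(2) by (elim trace_cases)
  have "Some \<alpha> \<in> insert None (Some ` X)" using assms(1) by simp
  then show ?thesis
    unfolding w(2) total_act_trace_of[OF w(1) \<open>Some \<alpha> \<in> _\<close>] by (rule foldl_total_step_closed)
qed

lemma total_act_adm: "x \<in> adm \<alpha> \<Longrightarrow> total_act E \<delta> (Some \<alpha>) x = Some (st \<alpha> x)"
  by (simp add: admissible_def act_def)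

lemma st_closed: "\<alpha> \<in> X \<Longrightarrow> x \<in> adm \<alpha> \<Longrightarrow> st \<alpha> x \<in> X"
  using total_act_closed[of \<alpha> x] total_act_adm[of x \<alpha>] adm_carrier[of x \<alpha>] by force

lemma total_act_None: "x \<in> carrier M \<Longrightarrow> total_act E \<delta> None x = None"
proof -
  assume "x \<in> carrier M"
  then obtain w where w: "w \<in> lists \<Sigma>" "x = tr w" by (elim trace_cases)
  have "foldl (total_step E \<delta>) None w = None" by (induction w) (simp_all add: total_step_def)
  then show ?thesis using w by (simp add: total_act_trace_of)
qed

lemma adm_mult:
  assumes "\<alpha> \<in> X" "x \<in> carrier M" "y \<in> carrier M"
  shows adm_mult_iff: "x \<otimes>\<^bsub>M\<^esub> y \<in> adm \<alpha> \<longleftrightarrow> x \<in> adm \<alpha> \<and> y \<in> adm (st \<alpha> x)"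
    and st_mult: "x \<in> adm \<alpha> \<Longrightarrow> st \<alpha> (x \<otimes>\<^bsub>M\<^esub> y) = st (st \<alpha> x) y"
proof -
  have *: "total_act E \<delta> (Some \<alpha>) (x \<otimes>\<^bsub>M\<^esub> y) = total_act E \<delta> (total_act E \<delta> (Some \<alpha>) x) y"
    using assms by (intro total_act_mult) simp_all
  show "x \<otimes>\<^bsub>M\<^esub> y \<in> adm \<alpha> \<longleftrightarrow> x \<in> adm \<alpha> \<and> y \<in> adm (st \<alpha> x)"
  proof (cases "x \<in> adm \<alpha>")
    case True
    then show ?thesis using * assms total_act_adm[OF True] by (simp add: admissible_def)
  next
    case False
    then have "total_act E \<delta> (Some \<alpha>) x = None" using assms by (simp add: admissible_def)
    then show ?thesis using * assms total_act_None[of y] by (simp add: admissible_def)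
  qed
  show "st \<alpha> (x \<otimes>\<^bsub>M\<^esub> y) = st (st \<alpha> x) y" if "x \<in> adm \<alpha>"
    using * unfolding total_act_adm[OF that]
    by (simp only: act_def[of E \<delta> \<alpha> "x \<otimes>\<^bsub>M\<^esub> y"] act_def[of E \<delta> "st \<alpha> x" y])
qed

lemma adm_one: assumes "\<alpha> \<in> X" shows one_adm: "\<one>\<^bsub>M\<^esub> \<in> adm \<alpha>" and st_one: "st \<alpha> \<one>\<^bsub>M\<^esub> = \<alpha>"
proof -
  have "total_act E \<delta> (Some \<alpha>) \<one>\<^bsub>M\<^esub> = Some \<alpha>"
    using total_act_trace_of[of "[]" "Some \<alpha>"] assms by (simp add: one_trace)
  then show "\<one>\<^bsub>M\<^esub> \<in> adm \<alpha>" "st \<alpha> \<one>\<^bsub>M\<^esub> = \<alpha>" by (simp_all add: admissible_def act_def)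
qed

lemma letter_adm:
  assumes "\<alpha> \<in> X" "a \<in> E \<alpha>"
  shows "tr [a] \<in> adm \<alpha>" "st \<alpha> (tr [a]) = \<delta> \<alpha> a"
proof -
  have a: "[a] \<in> lists \<Sigma>" using enabled_subset[OF assms(1)] assms(2) by auto
  have "total_act E \<delta> (Some \<alpha>) (tr [a]) = Some (\<delta> \<alpha> a)"
    using total_act_trace_of[OF a, of "Some \<alpha>"] assms by (simp add: total_step_def)
  then show "tr [a] \<in> adm \<alpha>" "st \<alpha> (tr [a]) = \<delta> \<alpha> a"
    using tr_closed[OF a] by (simp_all add: admissible_def act_def)
qed

text \<open>The orbit of \<alpha> is a sub-action, so irreducibility makes it all of
  \<open>X\<close>. Every comparison between states rests on this, and irreducibility enters nowhere
  else.\<close>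

lemma reachable:
  assumes "\<alpha> \<in> X" "\<beta> \<in> X"
  obtains x where "x \<in> adm \<alpha>" "st \<alpha> x = \<beta>"
proof -
  have "is_sub_action X E \<delta> (st \<alpha> ` adm \<alpha>)"
    unfolding is_sub_action_def
  proof (intro conjI ballI)
    show "st \<alpha> ` adm \<alpha> \<noteq> {}" using one_adm[OF assms(1)] by blast
    show "st \<alpha> ` adm \<alpha> \<subseteq> X" using st_closed[OF assms(1)] by blast
    fix \<gamma> a assume "\<gamma> \<in> st \<alpha> ` adm \<alpha>" "a \<in> E \<gamma>"
    then obtain x where x: "x \<in> adm \<alpha>" "\<gamma> = st \<alpha> x" by blast
    then have \<gamma>: "\<gamma> \<in> X" using st_closed assms by simp
    note l = letter_adm[OF \<gamma> \<open>a \<in> E \<gamma>\<close>]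
    have "x \<otimes>\<^bsub>M\<^esub> tr [a] \<in> adm \<alpha>" "st \<alpha> (x \<otimes>\<^bsub>M\<^esub> tr [a]) = \<delta> \<gamma> a"
      using adm_mult[OF assms(1) adm_carrier[OF x(1)] adm_carrier[OF l(1)]] x l by simp_all
    then show "\<delta> \<gamma> a \<in> st \<alpha> ` adm \<alpha>" by (metis imageI)
  qed
  then have "\<beta> \<in> st \<alpha> ` adm \<alpha>" using irreducible assms(2) unfolding irreducible_action_def by blast
  then show ?thesis using that by blast
qed

section \<open>Growth coefficients and their common radius of convergence\<close>

lemma words_of_len: "{x \<in> carrier M. len x = n} \<subseteq> tr ` {w. set w \<subseteq> \<Sigma> \<and> length w = n}"
proof
  fix x assume "x \<in> {x \<in> carrier M. len x = n}"
  moreover then obtain w where "w \<in> lists \<Sigma>" "x = tr w" by (blast elim: trace_cases)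
  ultimately show "x \<in> tr ` {w. set w \<subseteq> \<Sigma> \<and> length w = n}"
    by (intro image_eqI[of _ _ w]) (simp_all add: trace_length_trace_of in_lists_conv_set subset_eq)
qed

lemma finite_len: "finite {x \<in> carrier M. len x = n}"
  using words_of_len finite_lists_length_eq[OF finite_alphabet] by (rule finite_subset[OF _ finite_imageI])

lemma finite_adm_len: "finite {x \<in> adm \<alpha>. len x = n}"
  using finite_len[of n] by (rule finite_subset[rotated]) (blast dest: adm_carrier)

lemma coef_nonneg: "coef \<alpha> n \<ge> 0"
  by (simp add: growth_coeff_def)

lemma coef_le_power: "coef \<alpha> n \<le> real (card \<Sigma>) ^ n"
proof -
  have "card {x \<in> adm \<alpha>. len x = n} \<le> card {x \<in> carrier M. len x = n}"
    by (intro card_mono finite_len) (blast dest: adm_carrier)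
  also have "\<dots> \<le> card {w. set w \<subseteq> \<Sigma> \<and> length w = n}"
    using words_of_len finite_lists_length_eq[OF finite_alphabet] by (rule surj_card_le[rotated])
  also have "\<dots> = card \<Sigma> ^ n" using finite_alphabet by (rule card_lists_length_eq)
  finally show ?thesis unfolding growth_coeff_def by (simp flip: of_nat_power)
qed

text \<open>Every state enables some letter, so admissible traces can always be prolonged. The
  resulting bound \<open>coef_ge_1\<close> keeps the radius of convergence finite.\<close>

lemma adm_exists_len: "\<alpha> \<in> X \<Longrightarrow> \<exists>x\<in>adm \<alpha>. len x = n"
proof (induction n arbitrary: \<alpha>)
  case 0
  then show ?case using one_adm len_one by blast
next
  case (Suc n)
  then obtain a where a: "a \<in> E \<alpha>" using enabled_nonempty by blast
  note l = letter_adm[OF Suc.prems a]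
  obtain y where y: "y \<in> adm (\<delta> \<alpha> a)" "len y = n" using Suc.IH step_closed[OF Suc.prems a] by blast
  have "tr [a] \<otimes>\<^bsub>M\<^esub> y \<in> adm \<alpha>"
    using adm_mult_iff[OF Suc.prems adm_carrier[OF l(1)] adm_carrier[OF y(1)]] l y by simp
  moreover have "len (tr [a] \<otimes>\<^bsub>M\<^esub> y) = Suc n"
    using len_mult[OF adm_carrier[OF l(1)] adm_carrier[OF y(1)]] y trace_length_trace_of[of "[a]"]
      a enabled_subset[OF Suc.prems] by auto
  ultimately show ?case by blast
qed

lemma coef_ge_1: "\<alpha> \<in> X \<Longrightarrow> coef \<alpha> n \<ge> 1"
proof -
  assume "\<alpha> \<in> X"
  then have "{x \<in> adm \<alpha>. len x = n} \<noteq> {}" using adm_exists_len by blast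
  then have "card {x \<in> adm \<alpha>. len x = n} > 0" using finite_adm_len by (simp add: card_gt_0_iff)
  then show ?thesis unfolding growth_coeff_def by simp
qed

lemma inj_on_mult: "x \<in> carrier M \<Longrightarrow> inj_on ((\<otimes>\<^bsub>M\<^esub>) x) (carrier M)"
  by (intro inj_onI) (rule left_cancel)

text \<open>With \<open>inj_on_mult\<close> this identifies the multiples of \<open>x\<close> with a
  copy of \<open>adm (st \<alpha> x)\<close> shifted by \<open>len x\<close>, which is where the
  weight of the multiples comes from.\<close>

lemma adm_mult_image:
  assumes "\<alpha> \<in> X" "x \<in> adm \<alpha>"
  shows "(\<otimes>\<^bsub>M\<^esub>) x ` adm (st \<alpha> x) = {y \<in> adm \<alpha>. x divides\<^bsub>M\<^esub> y}"
proof (intro equalityI subsetI)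
  note x = adm_carrier[OF assms(2)]
  fix y assume "y \<in> (\<otimes>\<^bsub>M\<^esub>) x ` adm (st \<alpha> x)"
  then obtain z where z: "z \<in> adm (st \<alpha> x)" "y = x \<otimes>\<^bsub>M\<^esub> z" by (rule imageE)
  then show "y \<in> {y \<in> adm \<alpha>. x divides\<^bsub>M\<^esub> y}"
    using adm_mult_iff[OF assms(1) x adm_carrier[OF z(1)]] dividesI[OF adm_carrier[OF z(1)] z(2)] assms(2)
    by simp
next
  note x = adm_carrier[OF assms(2)]
  fix y assume y: "y \<in> {y \<in> adm \<alpha>. x divides\<^bsub>M\<^esub> y}"
  then obtain z where z: "z \<in> carrier M" "y = x \<otimes>\<^bsub>M\<^esub> z" by (blast elim: dividesE)
  then have "z \<in> adm (st \<alpha> x)" using adm_mult_iff[OF assms(1) x z(1)] y by simp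
  then show "y \<in> (\<otimes>\<^bsub>M\<^esub>) x ` adm (st \<alpha> x)" using z(2) by (rule image_eqI[rotated])
qed

lemma coef_shift:
  assumes "\<alpha> \<in> X" "x \<in> adm \<alpha>"
  shows "coef (st \<alpha> x) n \<le> coef \<alpha> (len x + n)"
proof -
  let ?A = "{y \<in> adm (st \<alpha> x). len y = n}"
  note x = adm_carrier[OF assms(2)]
  have "card ?A = card ((\<otimes>\<^bsub>M\<^esub>) x ` ?A)"
    using inj_on_mult[OF x] by (intro card_image[symmetric]) (blast intro: inj_on_subset dest: adm_carrier)
  also have "\<dots> \<le> card {y \<in> adm \<alpha>. len y = len x + n}"
  proof (intro card_mono finite_adm_len subsetI)
    fix y assume "y \<in> (\<otimes>\<^bsub>M\<^esub>) x ` ?A"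
    then obtain z where z: "z \<in> ?A" "y = x \<otimes>\<^bsub>M\<^esub> z" by (rule imageE)
    then have "y \<in> adm \<alpha>" using adm_mult_image[OF assms] by blast
    moreover have "z \<in> carrier M" using z(1) adm_carrier by blast
    ultimately show "y \<in> {y \<in> adm \<alpha>. len y = len x + n}"
      using z x by simp
  qed
  finally show ?thesis by (simp add: growth_coeff_def)
qed

text \<open>A representing word is cut after \<open>m\<close> letters. The cut depends on the word,
  so pairs of pieces only map onto the traces and an inequality results; the sum over
  \<open>X\<close> absorbs the unknown intermediate state.\<close>

lemma coef_submult: "\<alpha> \<in> X \<Longrightarrow> coef \<alpha> (m + n) \<le> coef \<alpha> m * (\<Sum>\<beta>\<in>X. coef \<beta> n)"
proof -
  assume \<alpha>: "\<alpha> \<in> X"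
  let ?A = "{u \<in> adm \<alpha>. len u = m}" and ?B = "\<lambda>u. {v \<in> adm (st \<alpha> u). len v = n}"
  have sub: "{y \<in> adm \<alpha>. len y = m + n} \<subseteq> (\<lambda>(u, v). u \<otimes>\<^bsub>M\<^esub> v) ` Sigma ?A ?B"
  proof
    fix y assume y: "y \<in> {y \<in> adm \<alpha>. len y = m + n}"
    then obtain w where w: "w \<in> lists \<Sigma>" "y = tr w" using adm_carrier by (blast elim: trace_cases)
    let ?u = "tr (take m w)" and ?v = "tr (drop m w)"
    have uv: "take m w \<in> lists \<Sigma>" "drop m w \<in> lists \<Sigma>"
      using w(1) by (auto dest: in_set_takeD in_set_dropD)
    have l: "length w = m + n" using y w by (simp add: trace_length_trace_of)
    have e: "y = ?u \<otimes>\<^bsub>M\<^esub> ?v" using w uv by (simp add: mult_trace_of)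
    have "?u \<in> adm \<alpha> \<and> ?v \<in> adm (st \<alpha> ?u)"
      using adm_mult_iff[OF \<alpha> tr_closed[OF uv(1)] tr_closed[OF uv(2)]] y e by simp
    then have "(?u, ?v) \<in> Sigma ?A ?B"
      using l trace_length_trace_of[OF uv(1)] trace_length_trace_of[OF uv(2)] by simp
    then show "y \<in> (\<lambda>(u, v). u \<otimes>\<^bsub>M\<^esub> v) ` Sigma ?A ?B"
      by (rule image_eqI[rotated]) (simp add: e)
  qed
  have fin: "finite ?A" "\<forall>u\<in>?A. finite (?B u)" using finite_adm_len by simp_all
  then have finS: "finite (Sigma ?A ?B)" by (intro finite_SigmaI) simp_all
  have "coef \<alpha> (m + n) \<le> real (card (Sigma ?A ?B))"
    unfolding growth_coeff_def of_nat_le_iff by (rule surj_card_le[OF finS sub])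
  also have "\<dots> = (\<Sum>u\<in>?A. coef (st \<alpha> u) n)"
    using card_SigmaI[OF fin] by (simp add: growth_coeff_def)
  also have "\<dots> \<le> (\<Sum>u\<in>?A. \<Sum>\<beta>\<in>X. coef \<beta> n)"
  proof (intro sum_mono)
    fix u assume "u \<in> ?A"
    then have "st \<alpha> u \<in> X" using st_closed \<alpha> by simp
    then show "coef (st \<alpha> u) n \<le> (\<Sum>\<beta>\<in>X. coef \<beta> n)"
      using finite_states coef_nonneg by (intro member_le_sum) simp_all
  qed
  also have "\<dots> = coef \<alpha> m * (\<Sum>\<beta>\<in>X. coef \<beta> n)" by (simp add: growth_coeff_def)
  finally show ?thesis .
qed

text \<open>A trace \<open>x\<close> leading from \<alpha> to \<beta> bounds the coefficients of
  \<beta> by those of \<alpha> shifted by \<open>len x\<close> (\<open>coef_shift\<close>), and a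
  shift does not affect convergence.\<close>

lemma conv_radius_le:
  assumes "\<alpha> \<in> X" "\<beta> \<in> X"
  shows "conv_radius (coef \<alpha>) \<le> conv_radius (coef \<beta>)"
proof (rule conv_radius_geI_ex)
  fix r :: real assume r: "0 < r" "ereal r < conv_radius (coef \<alpha>)"
  obtain x where x: "x \<in> adm \<alpha>" "st \<alpha> x = \<beta>" using reachable[OF assms] .
  have "summable (\<lambda>n. coef \<alpha> n * r ^ n)" using r by (intro summable_in_conv_radius) simp
  then have "summable (\<lambda>n. coef \<alpha> (n + len x) * r ^ (n + len x))" by (rule summable_ignore_initial_segment)
  then have "summable (\<lambda>n. coef \<alpha> (len x + n) * r ^ (n + len x) / r ^ len x)"
    by (intro summable_divide) (simp add: add.commute)
  then have "summable (\<lambda>n. coef \<alpha> (len x + n) * r ^ n)" using r by (simp add: power_add)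
  then have "summable (\<lambda>n. coef \<beta> n * r ^ n)"
  proof (rule summable_comparison_test'[where N = 0])
    fix n
    show "norm (coef \<beta> n * r ^ n) \<le> coef \<alpha> (len x + n) * r ^ n"
      using coef_shift[OF assms(1) x(1), of n] x r coef_nonneg[of \<beta> n] by (simp add: mult_right_mono)
  qed
  then show "\<exists>z. norm z = r \<and> summable (\<lambda>n. coef \<beta> n * z ^ n)"
    using r by (intro exI[of _ r]) simp
qed

lemma conv_radius_bounds:
  assumes "\<alpha> \<in> X"
  shows "0 < conv_radius (coef \<alpha>)" "conv_radius (coef \<alpha>) \<le> 1"
proof -
  \<comment> \<open>By \<open>coef_le_power\<close> the terms at this radius are at most
    \<open>(1 / 2) ^ n\<close>.\<close>
  let ?r = "1 / (2 * real (card \<Sigma>))"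
  have r: "?r > 0" using card_alphabet by simp
  have "summable (\<lambda>n. coef \<alpha> n * ?r ^ n)"
  proof (rule summable_comparison_test'[where N = 0])
    show "summable (\<lambda>n. (1 / 2 :: real) ^ n)" by (intro summable_geometric) simp
    fix n
    have "coef \<alpha> n * ?r ^ n \<le> real (card \<Sigma>) ^ n * ?r ^ n"
      using r by (intro mult_right_mono coef_le_power) simp
    also have "\<dots> = (1 / 2) ^ n" using card_alphabet by (simp flip: power_mult_distrib)
    finally show "norm (coef \<alpha> n * ?r ^ n) \<le> (1 / 2) ^ n" using r coef_nonneg[of \<alpha> n] by simp
  qed
  then have "ereal (norm ?r) \<le> conv_radius (coef \<alpha>)" by (rule conv_radius_geI)
  moreover have "0 < ereal (norm ?r)" using r by (simp only: ereal_less zero_less_norm_iff)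
  ultimately show "0 < conv_radius (coef \<alpha>)" by (rule less_le_trans[rotated])
  show "conv_radius (coef \<alpha>) \<le> 1"
  proof (rule ccontr)
    assume "\<not> ?thesis"
    then have "summable (\<lambda>n. coef \<alpha> n * 1 ^ n)" by (intro summable_in_conv_radius) (simp add: one_ereal_def)
    then have "(\<lambda>n. coef \<alpha> n) \<longlonglongrightarrow> 0" using summable_LIMSEQ_zero by force
    then have "1 \<le> (0::real)"
      by (rule tendsto_lowerbound[where F = sequentially]) (use coef_ge_1[OF assms] in simp_all)
    then show False by simp
  qed
qed

text \<open>\<open>conv_radius_le\<close> in both directions makes the radius common to all states,
  which settles the definite description. For empty \<open>X\<close> every real number would satisfy
  its condition, whence the assumption.\<close>

lemma char_root:
  assumes "X \<noteq> {}"
  shows char_root_pos: "0 < t\<^sub>0" and conv_radius_coef: "\<alpha> \<in> X \<Longrightarrow> conv_radius (coef \<alpha>) = ereal t\<^sub>0"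
proof -
  obtain \<alpha>\<^sub>0 where a: "\<alpha>\<^sub>0 \<in> X" using assms by blast
  obtain t where t: "conv_radius (coef \<alpha>\<^sub>0) = ereal t"
    using conv_radius_bounds[OF a] by (cases "conv_radius (coef \<alpha>\<^sub>0)") auto
  have all: "\<forall>\<beta>\<in>X. conv_radius (coef \<beta>) = ereal t"
    using conv_radius_le[OF a] conv_radius_le[OF _ a] t by (metis order_antisym)
  have "t\<^sub>0 = t" unfolding char_root_def by (rule the_equality) (use all t a in auto)
  then show "0 < t\<^sub>0" "\<alpha> \<in> X \<Longrightarrow> conv_radius (coef \<alpha>) = ereal t\<^sub>0"
    using all t conv_radius_bounds[OF a] by (simp_all flip: zero_ereal_def)
qed

end

section \<open>Growth series\<close>

lemma has_sum_finite_sum: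
  fixes f :: "'i \<Rightarrow> 'x \<Rightarrow> real"
  assumes "finite F" "\<And>i. i \<in> F \<Longrightarrow> (f i has_sum s i) A"
  shows "((\<lambda>x. \<Sum>i\<in>F. f i x) has_sum (\<Sum>i\<in>F. s i)) A"
  using assms by (induction F rule: finite_induct) (simp_all add: has_sum_0 has_sum_add)

text \<open>Obtained by expanding the product of the factors 1 - 1 over \<open>A\<close>, which is 0
  unless the product is empty.\<close>

lemma sum_alternating_subsets:
  assumes "finite A"
  shows "(\<Sum>S\<in>Pow A. (-1) ^ card S) = (if A = {} then 1 else (0::real))"
  using prod_diff_conv_sum[OF assms, of "\<lambda>_. 1" "\<lambda>_. 1 :: real"] assms
  by (simp add: power_0_left)

text \<open>Division-free Gaussian elimination of the unknown \<open>k\<close>. Being the identity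
  at 0 survives the cross-multiplication, so each pivot has value 1 at 0, and the common denominator
  \<open>q\<close>, built from the pivots, is nonzero there.\<close>

lemma linear_system_polynomial_solution:
  fixes A :: "'i \<Rightarrow> 'i \<Rightarrow> real poly" and b :: "'i \<Rightarrow> real poly" and f :: "'i \<Rightarrow> real \<Rightarrow> real"
  assumes "finite F"
    and "\<And>i j. i \<in> F \<Longrightarrow> j \<in> F \<Longrightarrow> poly (A i j) 0 = (if i = j then 1 else 0)"
    and "\<And>i t. i \<in> F \<Longrightarrow> t \<in> T \<Longrightarrow> (\<Sum>j\<in>F. poly (A i j) t * f j t) = poly (b i) t"
  shows "\<exists>q. poly q 0 \<noteq> 0 \<and> (\<forall>i\<in>F. \<exists>p. \<forall>t\<in>T. poly q t * f i t = poly p t)"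
  using assms
proof (induction F arbitrary: A b rule: finite_induct)
  case empty
  show ?case by (intro exI[of _ 1]) simp
next
  case (insert k F)
  let ?A = "\<lambda>i j. A k k * A i j - A i k * A k j" and ?b = "\<lambda>i. A k k * b i - A i k * b k"
  have k: "(\<Sum>j\<in>F. poly (A k j) t * f j t) = poly (b k) t - poly (A k k) t * f k t" if "t \<in> T" for t
    using insert.prems(2)[of k t] insert.hyps that by simp
  have "\<exists>q. poly q 0 \<noteq> 0 \<and> (\<forall>i\<in>F. \<exists>p. \<forall>t\<in>T. poly q t * f i t = poly p t)"
  proof (rule insert.IH)
    fix i j assume "i \<in> F" "j \<in> F"
    then show "poly (?A i j) 0 = (if i = j then 1 else 0)"
      using insert.prems(1)[of i j] insert.prems(1)[of k k] insert.prems(1)[of i k] insert.hyps by auto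
  next
    fix i t assume it: "i \<in> F" "t \<in> T"
    have i: "(\<Sum>j\<in>F. poly (A i j) t * f j t) = poly (b i) t - poly (A i k) t * f k t"
      using insert.prems(2)[of i t] insert.hyps it by simp
    have "(\<Sum>j\<in>F. poly (?A i j) t * f j t) =
        poly (A k k) t * (\<Sum>j\<in>F. poly (A i j) t * f j t) - poly (A i k) t * (\<Sum>j\<in>F. poly (A k j) t * f j t)"
      by (simp add: algebra_simps sum_subtractf sum_distrib_left)
    also have "\<dots> = poly (?b i) t" unfolding i k[OF it(2)] by (simp add: algebra_simps)
    finally show "(\<Sum>j\<in>F. poly (?A i j) t * f j t) = poly (?b i) t" .
  qed
  then obtain q where q: "poly q 0 \<noteq> 0" "\<forall>i\<in>F. \<exists>p. \<forall>t\<in>T. poly q t * f i t = poly p t" by blast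
  obtain p where p: "\<And>i t. i \<in> F \<Longrightarrow> t \<in> T \<Longrightarrow> poly q t * f i t = poly (p i) t"
    using bchoice[OF q(2)] by blast
  have "\<forall>i\<in>insert k F. \<exists>p. \<forall>t\<in>T. poly (q * A k k) t * f i t = poly p t"
  proof
    fix i assume i: "i \<in> insert k F"
    show "\<exists>p. \<forall>t\<in>T. poly (q * A k k) t * f i t = poly p t"
    proof (cases "i = k")
      case True
      have "poly (q * A k k) t * f k t = poly (q * b k - (\<Sum>j\<in>F. A k j * p j)) t" if "t \<in> T" for t
      proof -
        have "poly (q * A k k) t * f k t = poly q t * (poly (b k) t - (\<Sum>j\<in>F. poly (A k j) t * f j t))"
          unfolding k[OF that] by (simp add: algebra_simps)
        also have "\<dots> = poly q t * poly (b k) t - (\<Sum>j\<in>F. poly (A k j) t * (poly q t * f j t))"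
          by (simp add: algebra_simps sum_distrib_left)
        also have "\<dots> = poly (q * b k - (\<Sum>j\<in>F. A k j * p j)) t"
          using p that by (simp add: poly_sum)
        finally show ?thesis .
      qed
      then show ?thesis using True by blast
    next
      case False
      then have "poly (q * A k k) t * f i t = poly (A k k * p i) t" if "t \<in> T" for t
        using p[of i t] that i by (simp add: algebra_simps)
      then show ?thesis by blast
    qed
  qed
  moreover have "poly (q * A k k) 0 \<noteq> 0" using q(1) insert.prems(1)[of k k] by simp
  ultimately show ?case by blast
qed

text \<open>If \<open>q\<close> does not vanish at \<open>a\<close>, the limit is the quotient of
  the values. Otherwise boundedness of \<open>g\<close> forces \<open>p\<close> to vanish at
  \<open>a\<close> as well, and the common linear factor is cancelled, which lowers the degree of
  \<open>q\<close>.\<close>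

lemma bounded_rational_has_left_limit:
  fixes p q :: "real poly" and g :: "real \<Rightarrow> real"
  assumes "q \<noteq> 0" "\<forall>\<^sub>F t in at_left a. poly q t * g t = poly p t" "\<forall>\<^sub>F t in at_left a. \<bar>g t\<bar> \<le> C"
  shows "\<exists>l. (g \<longlongrightarrow> l) (at_left a)"
  using assms
proof (induction "degree q" arbitrary: p q rule: less_induct)
  case less
  have cont: "(poly r \<longlongrightarrow> poly r a) (at_left a)" for r :: "real poly"
  proof -
    have "isCont (poly r) a" by simp
    then show ?thesis by (simp add: isCont_def filterlim_at_split)
  qed
  show ?case
  proof (cases "poly q a = 0")
    case False
    have "((\<lambda>t. poly p t / poly q t) \<longlongrightarrow> poly p a / poly q a) (at_left a)"
      using cont False by (intro tendsto_divide)
    moreover have "\<forall>\<^sub>F t in at_left a. poly q t \<noteq> 0"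
      using cont[of q] False by (rule tendsto_imp_eventually_ne)
    then have "\<forall>\<^sub>F t in at_left a. poly p t / poly q t = g t"
      using less.prems(2) by eventually_elim (simp add: field_simps)
    ultimately have "(g \<longlongrightarrow> poly p a / poly q a) (at_left a)" by (rule Lim_transform_eventually)
    then show ?thesis by (rule exI)
  next
    case True
    have "((\<lambda>t. poly q t * g t) \<longlongrightarrow> 0) (at_left a)"
    proof (rule Lim_null_comparison)
      show "\<forall>\<^sub>F t in at_left a. norm (poly q t * g t) \<le> \<bar>poly q t\<bar> * C"
        using less.prems(3) by eventually_elim (simp add: abs_mult mult_left_mono)
      show "((\<lambda>t. \<bar>poly q t\<bar> * C) \<longlongrightarrow> 0) (at_left a)"
        using cont[of q] True by (intro tendsto_mult_left_zero tendsto_rabs_zero) simp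
    qed
    then have "(poly p \<longlongrightarrow> 0) (at_left a)"
      using less.prems(2) tendsto_cong[of "\<lambda>t. poly q t * g t" "poly p" "at_left a" 0] by simp
    then have "poly p a = 0" by (rule tendsto_unique[OF trivial_limit_at_left_real cont])
    then obtain p' q' where pq: "p = [:-a, 1:] * p'" "q = [:-a, 1:] * q'"
      using True poly_eq_0_iff_dvd by (metis dvdE)
    have q': "q' \<noteq> 0" using pq less.prems(1) by auto
    have "degree q = Suc (degree q')"
      unfolding pq(2) using q' by (subst degree_mult_eq) simp_all
    moreover have "\<forall>\<^sub>F t in at_left a. t \<noteq> a" by (simp add: eventually_at_filter)
    then have "\<forall>\<^sub>F t in at_left a. poly q' t * g t = poly p' t"
      using less.prems(2)
    proof eventually_elim
      case (elim t)
      have "(t - a) * (poly q' t * g t) = (t - a) * poly p' t"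
        using elim(2) by (simp add: pq algebra_simps)
      then show ?case using elim(1) unfolding mult_cancel_left by simp
    qed
    ultimately show ?thesis using less.hyps[of q' p'] q' less.prems(3) by simp
  qed
qed

context irreducible_partial_action
begin

abbreviation "gf A t \<equiv> \<Sum>\<^sub>\<infinity>x\<in>A. t ^ len x"
abbreviation "multiples \<alpha> x \<equiv> {y \<in> adm \<alpha>. x divides\<^bsub>M\<^esub> y}"

section \<open>Growth series below the characteristic root\<close>

lemma finite_adm_less: "finite {x \<in> adm \<alpha>. len x < n}"
proof -
  have "{x \<in> adm \<alpha>. len x < n} = (\<Union>k<n. {x \<in> adm \<alpha>. len x = k})" by blast
  then show ?thesis using finite_adm_len by simp
qed

lemma sum_adm_less: "(\<Sum>x | x \<in> adm \<alpha> \<and> len x < n. t ^ len x) = (\<Sum>k<n. coef \<alpha> k * t ^ k)"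
proof -
  have "(\<Sum>x | x \<in> adm \<alpha> \<and> len x < n. t ^ len x) =
      (\<Sum>k<n. \<Sum>x | x \<in> {x \<in> adm \<alpha>. len x < n} \<and> len x = k. t ^ len x)"
    using finite_adm_less by (intro sum.group[symmetric]) (simp_all add: image_subset_iff)
  also have "\<dots> = (\<Sum>k<n. \<Sum>x | x \<in> adm \<alpha> \<and> len x = k. t ^ k)"
    by (intro sum.cong) auto
  also have "\<dots> = (\<Sum>k<n. coef \<alpha> k * t ^ k)" by (simp add: growth_coeff_def)
  finally show ?thesis .
qed

lemma summable_adm:
  assumes "\<alpha> \<in> X" "0 \<le> t" "t < t\<^sub>0"
  shows "(\<lambda>x. t ^ len x) summable_on adm \<alpha>"
proof (rule nonneg_bdd_above_summable_on)
  have X: "X \<noteq> {}" using assms(1) by blast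
  have s: "summable (\<lambda>n. coef \<alpha> n * t ^ n)"
    using assms conv_radius_coef[OF X assms(1)] by (intro summable_in_conv_radius) simp
  show "bdd_above (sum (\<lambda>x. t ^ len x) ` {F. F \<subseteq> adm \<alpha> \<and> finite F})"
  proof (rule bdd_aboveI2)
    fix F assume "F \<in> {F. F \<subseteq> adm \<alpha> \<and> finite F}"
    then have F: "F \<subseteq> adm \<alpha>" "finite F" by simp_all
    \<comment> \<open>The sum of all lengths is a crude bound for each of them; \<open>Suc\<close>
      makes it strict.\<close>
    define n where "n = Suc (\<Sum>x\<in>F. len x)"
    have "len x < n" if "x \<in> F" for x
      using member_le_sum[OF that, of len] F(2) by (simp add: n_def)
    then have "F \<subseteq> {x \<in> adm \<alpha>. len x < n}" using F by blast
    then have "(\<Sum>x\<in>F. t ^ len x) \<le> (\<Sum>x | x \<in> adm \<alpha> \<and> len x < n. t ^ len x)"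
      using assms finite_adm_less by (intro sum_mono2) simp_all
    also have "\<dots> \<le> (\<Sum>n. coef \<alpha> n * t ^ n)"
      unfolding sum_adm_less using s assms coef_nonneg by (intro sum_le_suminf) simp_all
    finally show "(\<Sum>x\<in>F. t ^ len x) \<le> (\<Sum>n. coef \<alpha> n * t ^ n)" .
  qed
qed (use assms in simp)

lemma summable_subset:
  "\<alpha> \<in> X \<Longrightarrow> 0 \<le> t \<Longrightarrow> t < t\<^sub>0 \<Longrightarrow> A \<subseteq> adm \<alpha> \<Longrightarrow> (\<lambda>x. t ^ len x) summable_on A"
  using summable_adm by (rule summable_on_subset_banach)

lemma partial_sum_le_Z:
  assumes "\<alpha> \<in> X" "0 \<le> t" "t < t\<^sub>0"
  shows "(\<Sum>k<n. coef \<alpha> k * t ^ k) \<le> Z \<alpha> t"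
  unfolding growth_series_def sum_adm_less[symmetric] using assms summable_adm[OF assms] finite_adm_less
  by (intro finite_sum_le_infsum) simp_all

lemma Z_ge_1: "\<alpha> \<in> X \<Longrightarrow> 0 \<le> t \<Longrightarrow> t < t\<^sub>0 \<Longrightarrow> 1 \<le> Z \<alpha> t"
  using partial_sum_le_Z[of \<alpha> t 1] coef_ge_1[of \<alpha> 0] by simp

lemma gf_multiples:
  assumes "\<alpha> \<in> X" "x \<in> carrier M"
  shows "gf (multiples \<alpha> x) t = (if x \<in> adm \<alpha> then t ^ len x * Z (st \<alpha> x) t else 0)"
proof (cases "x \<in> adm \<alpha>")
  case True
  have "gf (multiples \<alpha> x) t = infsum ((\<lambda>y. t ^ len y) \<circ> (\<otimes>\<^bsub>M\<^esub>) x) (adm (st \<alpha> x))"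
    unfolding adm_mult_image[OF assms(1) True, symmetric] using inj_on_mult[OF assms(2)]
    by (intro infsum_reindex) (blast intro: inj_on_subset dest: adm_carrier)
  also have "\<dots> = (\<Sum>\<^sub>\<infinity>y\<in>adm (st \<alpha> x). t ^ len x * t ^ len y)"
    using assms(2) by (intro infsum_cong) (simp add: power_add adm_carrier)
  also have "\<dots> = t ^ len x * Z (st \<alpha> x) t"
    unfolding growth_series_def by (rule infsum_cmult_right')
  finally show ?thesis using True by simp
next
  case False
  then have "multiples \<alpha> x = {}" using adm_mult_iff[OF assms] by (blast elim: dividesE)
  then show ?thesis using False by (simp only: infsum_empty if_False)
qed

lemma Z_shift_le:
  assumes "\<alpha> \<in> X" "x \<in> adm \<alpha>" "0 \<le> t" "t < t\<^sub>0"
  shows "t ^ len x * Z (st \<alpha> x) t \<le> Z \<alpha> t"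
proof -
  have "gf (multiples \<alpha> x) t \<le> gf (adm \<alpha>) t"
    using assms(3) by (intro infsum_mono2 summable_subset[OF assms(1,3,4)]) auto
  then show ?thesis
    using gf_multiples[OF assms(1) adm_carrier[OF assms(2)]] assms(2) by (simp add: growth_series_def)
qed

section \<open>Comparison of states and divergence at the characteristic root\<close>

lemma eventually_below_char_root: "X \<noteq> {} \<Longrightarrow> \<forall>\<^sub>F t in at_left t\<^sub>0. 0 < t \<and> t < t\<^sub>0"
  using char_root_pos eventually_at_left_real[of 0 t\<^sub>0] by (auto elim: eventually_mono)

lemma Z_comparable:
  assumes "\<alpha> \<in> X" "\<beta> \<in> X"
  obtains C where "C > 0" "\<forall>\<^sub>F t in at_left t\<^sub>0. Z \<beta> t \<le> C * Z \<alpha> t"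
proof -
  have X: "X \<noteq> {}" using assms by blast
  note pos = char_root_pos[OF X]
  obtain x where x: "x \<in> adm \<alpha>" "st \<alpha> x = \<beta>" using reachable[OF assms] .
  \<comment> \<open>On this half-interval the power of \<open>t\<close> in \<open>Z_shift_le\<close>
    is bounded below, so the constant does not depend on \<open>t\<close>.\<close>
  have "\<forall>\<^sub>F t in at_left t\<^sub>0. t \<in> {t\<^sub>0 / 2 <..< t\<^sub>0}"
    using pos by (intro eventually_at_left_real) simp
  then have "\<forall>\<^sub>F t in at_left t\<^sub>0. Z \<beta> t \<le> (1 / (t\<^sub>0 / 2) ^ len x) * Z \<alpha> t"
  proof eventually_elim
    case (elim t)
    then have t: "t\<^sub>0 / 2 < t" "0 \<le> t" "t < t\<^sub>0" using pos by simp_all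
    have "(t\<^sub>0 / 2) ^ len x * Z \<beta> t \<le> t ^ len x * Z \<beta> t"
      using t pos Z_ge_1[OF assms(2) t(2,3)] by (intro mult_right_mono power_mono) simp_all
    also have "\<dots> \<le> Z \<alpha> t" using Z_shift_le[OF assms(1) x(1) t(2,3)] x(2) by simp
    finally show ?case using pos by (simp add: field_simps)
  qed
  moreover have "1 / (t\<^sub>0 / 2) ^ len x > 0" using pos by simp
  ultimately show ?thesis by (rule that[rotated])
qed

text \<open>If the bound failed for some \<open>n\<close>, continuity would give
  \<open>L n * s ^ n < 1\<close> for some \<open>s\<close> beyond t_0. By submultiplicativity all
  \<open>L k * s ^ k\<close> would stay bounded, and the radius of convergence would be at least
  \<open>s\<close>.\<close>

lemma total_coef_bound: "X \<noteq> {} \<Longrightarrow> 1 \<le> (\<Sum>\<beta>\<in>X. coef \<beta> n) * t\<^sub>0 ^ n"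
proof (rule ccontr)
  assume X: "X \<noteq> {}" and neg: "\<not> 1 \<le> (\<Sum>\<beta>\<in>X. coef \<beta> n) * t\<^sub>0 ^ n"
  define L where "L = (\<lambda>n. \<Sum>\<beta>\<in>X. coef \<beta> n)"
  obtain \<alpha> where \<alpha>: "\<alpha> \<in> X" using X by blast
  have coef_le: "coef \<alpha> k \<le> L k" for k
    unfolding L_def using \<alpha> finite_states coef_nonneg by (intro member_le_sum) simp_all
  have L0: "0 \<le> L k" for k unfolding L_def by (intro sum_nonneg coef_nonneg)
  have "n \<noteq> 0"
  proof
    assume "n = 0"
    then show False using neg coef_le[of 0] coef_ge_1[OF \<alpha>, of 0] by (simp add: L_def)
  qed
  have "((\<lambda>s. L n * s ^ n) \<longlongrightarrow> L n * t\<^sub>0 ^ n) (at_right t\<^sub>0)"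
    by (intro tendsto_intros)
  moreover have "L n * t\<^sub>0 ^ n < 1" using neg by (simp add: L_def not_le)
  ultimately have "\<forall>\<^sub>F s in at_right t\<^sub>0. L n * s ^ n < 1" by (rule order_tendstoD(2))
  moreover have "\<forall>\<^sub>F s in at_right t\<^sub>0. t\<^sub>0 < s" by (simp add: eventually_at_filter)
  ultimately have "\<forall>\<^sub>F s in at_right t\<^sub>0. L n * s ^ n < 1 \<and> t\<^sub>0 < s" by eventually_elim simp
  then obtain s where s: "L n * s ^ n < 1" "t\<^sub>0 < s"
    using eventually_happens'[OF trivial_limit_at_right_real] by blast
  have s0: "0 < s" using s char_root_pos[OF X] by simp
  \<comment> \<open>\<open>B\<close> dominates the terms with index below \<open>n\<close>; for a
    larger index, removing a block of length \<open>n\<close> costs only a factor less than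
    1.\<close>
  define B where "B = (\<Sum>r<n. L r * s ^ r)"
  have submult: "L (m + k) \<le> L m * L k" for m k
    unfolding L_def sum_distrib_right by (intro sum_mono coef_submult)
  have bound: "L k * s ^ k \<le> B" for k
  proof (induction k rule: less_induct)
    case (less k)
    show ?case
    proof (cases "k < n")
      case True
      then show ?thesis unfolding B_def using L0 s0
        by (intro member_le_sum[of k "{..<n}" "\<lambda>r. L r * s ^ r"]) simp_all
    next
      case False
      then have k: "k = n + (k - n)" by simp
      have "L k * s ^ k \<le> L n * L (k - n) * s ^ k"
        using submult[of n "k - n"] k s0 by (intro mult_right_mono) simp_all
      also have "\<dots> = (L n * s ^ n) * (L (k - n) * s ^ (k - n))"
        using k by (simp flip: power_add)
      also have "\<dots> \<le> 1 * B"
        using s s0 L0 less.IH[of "k - n"] False \<open>n \<noteq> 0\<close> by (intro mult_mono) simp_all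
      finally show ?thesis by simp
    qed
  qed
  have "ereal s \<le> conv_radius (coef \<alpha>)"
  proof (rule conv_radius_geI_ex')
    fix r :: real assume r: "0 < r" "ereal r < ereal s"
    show "summable (\<lambda>k. coef \<alpha> k * of_real r ^ k)"
    proof (rule summable_comparison_test'[where N = 0])
      show "summable (\<lambda>k. B * (r / s) ^ k)"
        using r s0 by (intro summable_mult summable_geometric) simp
      fix k
      have "coef \<alpha> k * r ^ k \<le> L k * r ^ k" using coef_le r by (intro mult_right_mono) simp_all
      also have "\<dots> = (L k * s ^ k) * (r / s) ^ k" using s0 by (simp add: power_divide)
      also have "\<dots> \<le> B * (r / s) ^ k" using bound r s0 by (intro mult_right_mono) simp_all
      finally show "norm (coef \<alpha> k * of_real r ^ k) \<le> B * (r / s) ^ k"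
        using coef_nonneg[of \<alpha> k] r by simp
    qed
  qed
  then show False using conv_radius_coef[OF X \<alpha>] s by simp
qed

text \<open>By \<open>total_coef_bound\<close> every degree contributes at least 1 at t_0 to the sum
  of the series over all states, so that sum diverges. Comparability of the states passes the
  divergence on to each single series.\<close>

lemma Z_tendsto_at_top:
  assumes "\<alpha> \<in> X"
  shows "filterlim (Z \<alpha>) at_top (at_left t\<^sub>0)"
proof -
  have X: "X \<noteq> {}" using assms by blast
  have "\<exists>C. C > 0 \<and> (\<forall>\<^sub>F t in at_left t\<^sub>0. Z \<beta> t \<le> C * Z \<alpha> t)" if "\<beta> \<in> X" for \<beta>
    by (rule Z_comparable[OF assms that]) (intro exI conjI)
  then obtain C where C: "\<And>\<beta>. \<beta> \<in> X \<Longrightarrow> C \<beta> > 0 \<and> (\<forall>\<^sub>F t in at_left t\<^sub>0. Z \<beta> t \<le> C \<beta> * Z \<alpha> t)"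
    using bchoice[of X "\<lambda>\<beta> C. C > 0 \<and> (\<forall>\<^sub>F t in at_left t\<^sub>0. Z \<beta> t \<le> C * Z \<alpha> t)"] by blast
  define K where "K = (\<Sum>\<beta>\<in>X. C \<beta>)"
  have K: "K > 0" unfolding K_def using X finite_states C by (intro sum_pos) simp_all
  have "\<forall>\<^sub>F t in at_left t\<^sub>0. \<forall>\<beta>\<in>X. Z \<beta> t \<le> C \<beta> * Z \<alpha> t"
    using C finite_states by (intro eventually_ball_finite) simp_all
  then have le: "\<forall>\<^sub>F t in at_left t\<^sub>0. (\<Sum>\<beta>\<in>X. Z \<beta> t) \<le> K * Z \<alpha> t"
    by eventually_elim (simp add: K_def sum_distrib_right sum_mono)
  have "filterlim (\<lambda>t. \<Sum>\<beta>\<in>X. Z \<beta> t) at_top (at_left t\<^sub>0)"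
  proof (rule filterlim_at_top_gt[THEN iffD2, of 0], intro allI impI)
    fix c :: real
    \<comment> \<open>The first \<open>N\<close> coefficients contribute at least \<open>N\<close>
      at t_0, hence more than \<open>c\<close>, and by continuity still more than \<open>c\<close>
      slightly below t_0.\<close>
    define N where "N = Suc (nat \<lceil>c\<rceil>)"
    have N: "c < real N" unfolding N_def by linarith
    let ?f = "\<lambda>t. \<Sum>\<beta>\<in>X. \<Sum>k<N. coef \<beta> k * t ^ k"
    have "?f t\<^sub>0 = (\<Sum>k<N. (\<Sum>\<beta>\<in>X. coef \<beta> k) * t\<^sub>0 ^ k)"
      by (subst sum.swap) (simp add: sum_distrib_right)
    also have "\<dots> \<ge> (\<Sum>k<N. 1)" by (intro sum_mono total_coef_bound X)
    finally have "c < ?f t\<^sub>0" using N by simp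
    moreover have "(?f \<longlongrightarrow> ?f t\<^sub>0) (at_left t\<^sub>0)" by (intro tendsto_intros)
    ultimately have "\<forall>\<^sub>F t in at_left t\<^sub>0. c < ?f t" by (intro order_tendstoD(1))
    then show "\<forall>\<^sub>F t in at_left t\<^sub>0. c \<le> (\<Sum>\<beta>\<in>X. Z \<beta> t)"
      using eventually_below_char_root[OF X]
    proof eventually_elim
      case (elim t)
      then have "?f t \<le> (\<Sum>\<beta>\<in>X. Z \<beta> t)" by (intro sum_mono partial_sum_le_Z) simp_all
      then show ?case using elim by simp
    qed
  qed
  then have "filterlim (\<lambda>t. K * Z \<alpha> t) at_top (at_left t\<^sub>0)"
    using le by (rule filterlim_at_top_mono)
  then have "filterlim (\<lambda>t. 1 / K * (K * Z \<alpha> t)) at_top (at_left t\<^sub>0)"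
    by (rule filterlim_tendsto_pos_mult_at_top[OF tendsto_const, rotated]) (simp add: K)
  moreover have "(\<lambda>t. 1 / K * (K * Z \<alpha> t)) = Z \<alpha>" using K by (simp add: fun_eq_iff)
  ultimately show ?thesis by (simp only:)
qed

text \<open>Moebius inversion: the cliques dividing \<open>y\<close> are the subsets of the set of minimal letters of \<open>y\<close>,
  so summing \<open>(-1) ^ card S\<close> over them leaves only \<open>y = 1\<close>.\<close>

lemma moebius_system:
  assumes "\<alpha> \<in> X" "0 \<le> t" "t < t\<^sub>0"
  shows "(\<Sum>S | S \<subseteq> \<Sigma> \<and> indep S.
    if cl S \<in> adm \<alpha> then (- t) ^ card S * Z (st \<alpha> (cl S)) t else 0) = 1"
proof -
  let ?C = "{S. S \<subseteq> \<Sigma> \<and> indep S}"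
  have finC: "finite ?C" by (rule finite_subset[of _ "Pow \<Sigma>"]) (use finite_alphabet in auto)
  have summand: "((\<lambda>y. if S \<subseteq> mins y then (-1) ^ card S * t ^ len y else 0) has_sum
      (if cl S \<in> adm \<alpha> then (- t) ^ card S * Z (st \<alpha> (cl S)) t else 0)) (adm \<alpha>)" if "S \<in> ?C" for S
  proof -
    have S: "S \<subseteq> \<Sigma>" "indep S" using that by simp_all
    have "((\<lambda>y. t ^ len y) has_sum gf (multiples \<alpha> (cl S)) t) (multiples \<alpha> (cl S))"
      using assms by (intro has_sum_infsum summable_subset[OF assms]) blast
    then have "((\<lambda>y. (-1) ^ card S * t ^ len y) has_sum (-1) ^ card S * gf (multiples \<alpha> (cl S)) t)
        (multiples \<alpha> (cl S))" by (rule has_sum_cmult_right)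
    also have "?this \<longleftrightarrow> ((\<lambda>y. if S \<subseteq> mins y then (-1) ^ card S * t ^ len y else 0) has_sum
        (-1) ^ card S * gf (multiples \<alpha> (cl S)) t) (adm \<alpha>)"
      using cl_divides_iff[OF adm_carrier S] by (intro has_sum_cong_neutral) auto
    also have "(-1) ^ card S * gf (multiples \<alpha> (cl S)) t =
        (if cl S \<in> adm \<alpha> then (- t) ^ card S * Z (st \<alpha> (cl S)) t else 0)"
      using gf_multiples[OF assms(1) cl_closed[OF S]] len_cl[OF S] power_minus[of t "card S"] by simp
    finally show ?thesis .
  qed
  \<comment> \<open>The double sum over pairs of \<open>S\<close> and \<open>y\<close> is evaluated
    twice: over \<open>y\<close> first it gives the terms with \<open>Z\<close>, over
    \<open>S\<close> first only the trivial trace remains.\<close>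
  have "((\<lambda>y. \<Sum>S\<in>?C. if S \<subseteq> mins y then (-1) ^ card S * t ^ len y else 0) has_sum
      (\<Sum>S\<in>?C. if cl S \<in> adm \<alpha> then (- t) ^ card S * Z (st \<alpha> (cl S)) t else 0)) (adm \<alpha>)"
    using finC summand by (rule has_sum_finite_sum)
  also have "?this \<longleftrightarrow> ((\<lambda>y. 1) has_sum
      (\<Sum>S\<in>?C. if cl S \<in> adm \<alpha> then (- t) ^ card S * Z (st \<alpha> (cl S)) t else 0)) {\<one>\<^bsub>M\<^esub>}"
  proof (rule has_sum_cong_neutral)
    have *: "(\<Sum>S\<in>?C. if S \<subseteq> mins y then (-1) ^ card S * t ^ len y else 0) =
        (if y = \<one>\<^bsub>M\<^esub> then 1 else 0)" if "y \<in> adm \<alpha>" for y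
    proof -
      note y = adm_carrier[OF that]
      have m: "mins y \<subseteq> \<Sigma>" using mins_subset[OF y] letters_subset[OF y] by (rule subset_trans)
      have "indep S" if "S \<subseteq> mins y" for S using mins_indep[OF y] that by (rule pairwise_subset)
      then have "{S \<in> ?C. S \<subseteq> mins y} = Pow (mins y)" using m by blast
      then have "(\<Sum>S\<in>?C. if S \<subseteq> mins y then (-1) ^ card S * t ^ len y else 0) =
          (\<Sum>S\<in>Pow (mins y). (-1) ^ card S * t ^ len y)"
        using finC by (simp flip: sum.inter_filter)
      also have "\<dots> = (\<Sum>S\<in>Pow (mins y). (-1) ^ card S) * t ^ len y" by (simp add: sum_distrib_right)
      also have "\<dots> = (if y = \<one>\<^bsub>M\<^esub> then 1 else 0)"
        using sum_alternating_subsets[of "mins y"] finite_subset[OF m finite_alphabet]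
          mins_empty_iff[OF y] len_one by simp
      finally show ?thesis .
    qed
    show "(\<Sum>S\<in>?C. if S \<subseteq> mins y then (-1) ^ card S * t ^ len y else 0) = 0"
      if "y \<in> adm \<alpha> - {\<one>\<^bsub>M\<^esub>}" for y
      unfolding *[OF DiffD1[OF that]] using that by simp
    show "(\<Sum>S\<in>?C. if S \<subseteq> mins y then (-1) ^ card S * t ^ len y else 0) = 1"
      if "y \<in> adm \<alpha> \<inter> {\<one>\<^bsub>M\<^esub>}" for y
      unfolding *[OF IntD1[OF that]] using that by simp
  qed (use one_adm[OF assms(1)] in simp)
  finally have "((\<lambda>y. 1) has_sum
      (\<Sum>S\<in>?C. if cl S \<in> adm \<alpha> then (- t) ^ card S * Z (st \<alpha> (cl S)) t else 0)) {\<one>\<^bsub>M\<^esub>}" .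
  moreover have "((\<lambda>y. 1) has_sum 1) {\<one>\<^bsub>M\<^esub>}" by (rule has_sum_finiteI) simp_all
  ultimately show ?thesis by (rule has_sum_unique)
qed

text \<open>\<open>moebius_system\<close> is sorted by target state: the entry for \<alpha> and
  \<beta> collects the cliques leading from \<alpha> to \<beta>. At t = 0 only the empty clique
  contributes, and it fixes every state.\<close>

lemma Z_rational:
  "\<exists>q. poly q 0 \<noteq> 0 \<and> (\<forall>\<alpha>\<in>X. \<exists>p. \<forall>t\<in>{0..<t\<^sub>0}. poly q t * Z \<alpha> t = poly p t)"
proof (rule linear_system_polynomial_solution[OF finite_states])
  let ?C = "{S. S \<subseteq> \<Sigma> \<and> indep S}"
  define A :: "'s \<Rightarrow> 's \<Rightarrow> real poly" where
    "A = (\<lambda>\<alpha> \<beta>. \<Sum>S\<in>?C. if cl S \<in> adm \<alpha> \<and> st \<alpha> (cl S) = \<beta> then monom ((-1) ^ card S) (card S) else 0)"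
  have finC: "finite ?C" by (rule finite_subset[of _ "Pow \<Sigma>"]) (use finite_alphabet in auto)
  have poly_A: "poly (A \<alpha> \<beta>) t =
      (\<Sum>S\<in>?C. if cl S \<in> adm \<alpha> \<and> st \<alpha> (cl S) = \<beta> then (- t) ^ card S else 0)" for \<alpha> \<beta> t
    unfolding A_def poly_sum by (intro sum.cong HOL.refl) (simp add: poly_monom power_minus[of t])
  show "poly (A \<alpha> \<beta>) 0 = (if \<alpha> = \<beta> then 1 else 0)" if "\<alpha> \<in> X" "\<beta> \<in> X" for \<alpha> \<beta>
  proof -
    have "poly (A \<alpha> \<beta>) 0 = (\<Sum>S\<in>?C. if S = {} then (if \<alpha> = \<beta> then 1 else 0) else 0)"
      unfolding poly_A
    proof (intro sum.cong HOL.refl)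
      fix S assume "S \<in> ?C"
      then have "finite S" using finite_subset[OF _ finite_alphabet] by blast
      then show "(if cl S \<in> adm \<alpha> \<and> st \<alpha> (cl S) = \<beta> then (- 0) ^ card S else 0) =
          (if S = {} then (if \<alpha> = \<beta> then 1 else (0::real)) else 0)"
        using adm_one[OF that(1)] by (cases "S = {}") (simp_all add: cl_empty power_0_left)
    qed
    also have "\<dots> = (if \<alpha> = \<beta> then 1 else 0)"
      using finC by (simp add: sum.delta)
    finally show ?thesis .
  qed
  show "(\<Sum>\<beta>\<in>X. poly (A \<alpha> \<beta>) t * Z \<beta> t) = poly 1 t" if "\<alpha> \<in> X" "t \<in> {0..<t\<^sub>0}" for \<alpha> t
  proof -
    have "(\<Sum>\<beta>\<in>X. poly (A \<alpha> \<beta>) t * Z \<beta> t) =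
        (\<Sum>S\<in>?C. \<Sum>\<beta>\<in>X. (if cl S \<in> adm \<alpha> \<and> st \<alpha> (cl S) = \<beta> then (- t) ^ card S else 0) * Z \<beta> t)"
      unfolding poly_A sum_distrib_right by (rule sum.swap)
    also have "\<dots> = (\<Sum>S\<in>?C. if cl S \<in> adm \<alpha> then (- t) ^ card S * Z (st \<alpha> (cl S)) t else 0)"
    proof (intro sum.cong HOL.refl)
      fix S assume "S \<in> ?C"
      have "(\<Sum>\<beta>\<in>X. (if st \<alpha> (cl S) = \<beta> then (- t) ^ card S else 0) * Z \<beta> t) =
          (\<Sum>\<beta>\<in>X. if st \<alpha> (cl S) = \<beta> then (- t) ^ card S * Z \<beta> t else 0)"
        by (intro sum.cong) simp_all
      then show "(\<Sum>\<beta>\<in>X. (if cl S \<in> adm \<alpha> \<and> st \<alpha> (cl S) = \<beta> then (- t) ^ card S else 0) * Z \<beta> t) =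
          (if cl S \<in> adm \<alpha> then (- t) ^ card S * Z (st \<alpha> (cl S)) t else 0)"
        using st_closed[OF that(1), of "cl S"] finite_states by (cases "cl S \<in> adm \<alpha>") simp_all
    qed
    also have "\<dots> = 1" using that by (intro moebius_system) simp_all
    finally show ?thesis by simp
  qed
qed

section \<open>Existence, positivity and cocycle identity of the Parry cocycle\<close>

abbreviation "\<Gamma> \<equiv> parry_cocycle \<Sigma> I X E \<delta>"

text \<open>The common denominator \<open>q\<close> drops out of the ratio, which therefore
  satisfies a polynomial relation with coefficients \<open>a\<close> and \<open>b\<close>.
  Comparability bounds the ratio above, which gives the limit, and away from 0, which gives
  positivity.\<close>

lemma parry_limit:
  assumes "\<alpha> \<in> X" "\<beta> \<in> X"
  shows tendsto_parry: "((\<lambda>t. Z \<beta> t / Z \<alpha> t) \<longlongrightarrow> \<Gamma> \<alpha> \<beta>) (at_left t\<^sub>0)" and parry_pos: "\<Gamma> \<alpha> \<beta> > 0"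
proof -
  have X: "X \<noteq> {}" using assms by blast
  note below = eventually_below_char_root[OF X]
  obtain q where q: "poly q 0 \<noteq> 0" "\<And>\<gamma>. \<gamma> \<in> X \<Longrightarrow> \<exists>p. \<forall>t\<in>{0..<t\<^sub>0}. poly q t * Z \<gamma> t = poly p t"
    using Z_rational by blast
  obtain a b where ab: "\<And>t. t \<in> {0..<t\<^sub>0} \<Longrightarrow> poly q t * Z \<alpha> t = poly a t"
    "\<And>t. t \<in> {0..<t\<^sub>0} \<Longrightarrow> poly q t * Z \<beta> t = poly b t"
    using q(2)[OF assms(1)] q(2)[OF assms(2)] by blast
  \<comment> \<open>At 0 the value of \<open>a\<close> is the product of \<open>poly q 0\<close> and
    \<open>Z \<alpha> 0\<close>, both nonzero; this excludes the trivial relation.\<close>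
  have "poly a 0 \<noteq> 0" using ab(1)[of 0] q(1) Z_ge_1[OF assms(1), of 0] char_root_pos[OF X] by auto
  then have "a \<noteq> 0" by auto
  moreover have "\<forall>\<^sub>F t in at_left t\<^sub>0. poly a t * (Z \<beta> t / Z \<alpha> t) = poly b t"
    using below
  proof eventually_elim
    case (elim t)
    then show ?case using ab[of t, symmetric] Z_ge_1[OF assms(1), of t] by simp
  qed
  moreover obtain C where C: "C > 0" "\<forall>\<^sub>F t in at_left t\<^sub>0. Z \<beta> t \<le> C * Z \<alpha> t"
    by (rule Z_comparable[OF assms])
  moreover have "\<forall>\<^sub>F t in at_left t\<^sub>0. \<bar>Z \<beta> t / Z \<alpha> t\<bar> \<le> C"
    using C(2) below
  proof eventually_elim
    case (elim t)
    then show ?case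
      using Z_ge_1[OF assms(1), of t] Z_ge_1[OF assms(2), of t] by (simp add: divide_le_eq)
  qed
  ultimately obtain l where l: "((\<lambda>t. Z \<beta> t / Z \<alpha> t) \<longlongrightarrow> l) (at_left t\<^sub>0)"
    using bounded_rational_has_left_limit[where g = "\<lambda>t. Z \<beta> t / Z \<alpha> t"] by blast
  then have "\<Gamma> \<alpha> \<beta> = l" unfolding parry_cocycle_def by (intro tendsto_Lim) simp_all
  with l show lim: "((\<lambda>t. Z \<beta> t / Z \<alpha> t) \<longlongrightarrow> \<Gamma> \<alpha> \<beta>) (at_left t\<^sub>0)" by simp
  obtain D where D: "D > 0" "\<forall>\<^sub>F t in at_left t\<^sub>0. Z \<alpha> t \<le> D * Z \<beta> t"
    by (rule Z_comparable[OF assms(2,1)])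
  have "\<forall>\<^sub>F t in at_left t\<^sub>0. 1 / D \<le> Z \<beta> t / Z \<alpha> t"
    using D(2) below
  proof eventually_elim
    case (elim t)
    then show ?case
      using Z_ge_1[OF assms(1), of t] Z_ge_1[OF assms(2), of t] D(1) by (simp add: field_simps)
  qed
  then have "1 / D \<le> \<Gamma> \<alpha> \<beta>"
    using tendsto_lowerbound[OF lim _ trivial_limit_at_left_real] by blast
  then show "\<Gamma> \<alpha> \<beta> > 0" using D(1) by (smt (verit) divide_pos_pos)
qed

lemma parry_cocycle_mult:
  assumes "\<alpha> \<in> X" "\<beta> \<in> X" "\<gamma> \<in> X"
  shows "\<Gamma> \<alpha> \<beta> * \<Gamma> \<beta> \<gamma> = \<Gamma> \<alpha> \<gamma>"
proof -
  have X: "X \<noteq> {}" using assms by blast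
  have "((\<lambda>t. Z \<beta> t / Z \<alpha> t * (Z \<gamma> t / Z \<beta> t)) \<longlongrightarrow> \<Gamma> \<alpha> \<beta> * \<Gamma> \<beta> \<gamma>) (at_left t\<^sub>0)"
    by (intro tendsto_mult tendsto_parry assms)
  moreover have "\<forall>\<^sub>F t in at_left t\<^sub>0. Z \<beta> t / Z \<alpha> t * (Z \<gamma> t / Z \<beta> t) = Z \<gamma> t / Z \<alpha> t"
    using eventually_below_char_root[OF X]
  proof eventually_elim
    case (elim t)
    then show ?case using Z_ge_1[OF assms(2), of t] by simp
  qed
  ultimately have "((\<lambda>t. Z \<gamma> t / Z \<alpha> t) \<longlongrightarrow> \<Gamma> \<alpha> \<beta> * \<Gamma> \<beta> \<gamma>) (at_left t\<^sub>0)"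
    by (rule Lim_transform_eventually)
  then show ?thesis by (rule tendsto_unique[OF trivial_limit_at_left_real _ tendsto_parry[OF assms(1,3)]])
qed

end

section \<open>Limit densities of prefix sets\<close>

context irreducible_partial_action
begin

text \<open>A predicate rather than a value, since the limit need not exist for an arbitrary set.
  The inclusion in \<open>adm \<alpha>\<close> guarantees summability below t_0 in the additivity
  rules.\<close>

definition has_density :: "'s \<Rightarrow> 'a trace set \<Rightarrow> real \<Rightarrow> bool" where
  "has_density \<alpha> A r \<longleftrightarrow> A \<subseteq> adm \<alpha> \<and> ((\<lambda>t. gf A t / Z \<alpha> t) \<longlongrightarrow> r) (at_left t\<^sub>0)"

definition "trace_density \<alpha> A = Lim (at_left t\<^sub>0) (\<lambda>t. gf A t / Z \<alpha> t)"

definition normal_words :: "nat \<Rightarrow> 'a trace list set" where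
  "normal_words n = {h. is_normal \<Sigma> I h \<and> length h = n}"

text \<open>A trace with fewer than \<open>length h\<close> cliques is in no such set, since its
  truncation is too short. This causes the remainder sets in the decompositions below.\<close>

definition prefixed :: "'s \<Rightarrow> 'a trace list \<Rightarrow> 'a trace set" where
  "prefixed \<alpha> h = {y \<in> adm \<alpha>. take (length h) (nf y) = h}"

text \<open>The value 0 on words that are not normal makes the weights consistent over all words in
  cliques, so that the sequence space need not know about the arrow condition.\<close>

definition prefix_prob :: "'s \<Rightarrow> 'a trace list \<Rightarrow> real" where
  "prefix_prob \<alpha> h = (if is_normal \<Sigma> I h then trace_density \<alpha> (prefixed \<alpha> h) else 0)"

section \<open>Calculus of densities\<close>

lemma has_density_unique: "has_density \<alpha> A r \<Longrightarrow> has_density \<alpha> A s \<Longrightarrow> r = s"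
  unfolding has_density_def by (elim conjE) (rule tendsto_unique[OF trivial_limit_at_left_real])

lemma has_density_trace_density: "has_density \<alpha> A r \<Longrightarrow> has_density \<alpha> A (trace_density \<alpha> A)"
  unfolding has_density_def trace_density_def
  using tendsto_Lim[OF trivial_limit_at_left_real, of "\<lambda>t. gf A t / Z \<alpha> t" r] by simp

lemma has_density_adm: "\<alpha> \<in> X \<Longrightarrow> has_density \<alpha> (adm \<alpha>) 1"
proof -
  assume a: "\<alpha> \<in> X"
  then have "X \<noteq> {}" by blast
  from eventually_below_char_root[OF this]
  have "\<forall>\<^sub>F t in at_left t\<^sub>0. 1 = gf (adm \<alpha>) t / Z \<alpha> t"
  proof eventually_elim
    case (elim t)
    then show ?case using Z_ge_1[OF a, of t] by (simp add: growth_series_def)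
  qed
  then have "((\<lambda>t. gf (adm \<alpha>) t / Z \<alpha> t) \<longlongrightarrow> 1) (at_left t\<^sub>0)"
    by (rule Lim_transform_eventually[OF tendsto_const])
  then show ?thesis unfolding has_density_def by (intro conjI subset_refl)
qed

lemma has_density_nonneg:
  assumes "\<alpha> \<in> X" "has_density \<alpha> A r" shows "0 \<le> r"
proof -
  have "X \<noteq> {}" using assms by blast
  from eventually_below_char_root[OF this]
  have le: "\<forall>\<^sub>F t in at_left t\<^sub>0. 0 \<le> gf A t / Z \<alpha> t"
  proof eventually_elim
    case (elim t)
    then have "0 \<le> gf A t" by (intro infsum_nonneg) simp
    then show ?case using Z_ge_1[OF assms(1), of t] elim by simp
  qed
  have lim: "((\<lambda>t. gf A t / Z \<alpha> t) \<longlongrightarrow> r) (at_left t\<^sub>0)"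
    using assms(2) unfolding has_density_def by (rule conjunct2)
  show ?thesis by (rule tendsto_lowerbound[OF lim le trivial_limit_at_left_real])
qed

lemma has_density_finite:
  assumes "\<alpha> \<in> X" "finite A" "A \<subseteq> adm \<alpha>" shows "has_density \<alpha> A 0"
proof -
  have "((\<lambda>t. \<Sum>x\<in>A. t ^ len x) \<longlongrightarrow> (\<Sum>x\<in>A. t\<^sub>0 ^ len x)) (at_left t\<^sub>0)"
    by (intro tendsto_intros)
  then have "((\<lambda>t. (\<Sum>x\<in>A. t ^ len x) / Z \<alpha> t) \<longlongrightarrow> 0) (at_left t\<^sub>0)"
    by (rule tendsto_divide_0) (intro filterlim_at_top_imp_at_infinity Z_tendsto_at_top assms)
  then show ?thesis using assms by (simp add: has_density_def)
qed

lemma has_density_Un: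
  assumes "\<alpha> \<in> X" "has_density \<alpha> A a" "has_density \<alpha> B b" "A \<inter> B = {}"
  shows "has_density \<alpha> (A \<union> B) (a + b)"
proof -
  have sub: "A \<subseteq> adm \<alpha>" "B \<subseteq> adm \<alpha>" using assms by (simp_all add: has_density_def)
  have "X \<noteq> {}" using assms by blast
  from eventually_below_char_root[OF this]
  have "\<forall>\<^sub>F t in at_left t\<^sub>0. gf A t / Z \<alpha> t + gf B t / Z \<alpha> t = gf (A \<union> B) t / Z \<alpha> t"
  proof eventually_elim
    case (elim t)
    have "gf (A \<union> B) t = gf A t + gf B t"
      using elim assms(4) sub by (intro infsum_Un_disjoint summable_subset[OF assms(1)]) simp_all
    then show ?case by (simp add: add_divide_distrib)
  qed
  moreover have "((\<lambda>t. gf A t / Z \<alpha> t + gf B t / Z \<alpha> t) \<longlongrightarrow> a + b) (at_left t\<^sub>0)"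
    using assms(2,3) by (intro tendsto_add) (simp_all add: has_density_def)
  ultimately have "((\<lambda>t. gf (A \<union> B) t / Z \<alpha> t) \<longlongrightarrow> a + b) (at_left t\<^sub>0)"
    by (rule Lim_transform_eventually[rotated])
  then show ?thesis using sub unfolding has_density_def by (intro conjI) auto
qed

lemma has_density_Diff:
  assumes "\<alpha> \<in> X" "has_density \<alpha> A a" "has_density \<alpha> B b" "B \<subseteq> A"
  shows "has_density \<alpha> (A - B) (a - b)"
proof -
  have sub: "A \<subseteq> adm \<alpha>" "B \<subseteq> adm \<alpha>" using assms by (simp_all add: has_density_def)
  have "X \<noteq> {}" using assms by blast
  from eventually_below_char_root[OF this]
  have "\<forall>\<^sub>F t in at_left t\<^sub>0. gf A t / Z \<alpha> t - gf B t / Z \<alpha> t = gf (A - B) t / Z \<alpha> t"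
  proof eventually_elim
    case (elim t)
    have "gf (B \<union> (A - B)) t = gf B t + gf (A - B) t"
      using elim sub by (intro infsum_Un_disjoint summable_subset[OF assms(1)]) auto
    moreover have "B \<union> (A - B) = A" using assms(4) by blast
    ultimately show ?case by (simp add: diff_divide_distrib[symmetric])
  qed
  moreover have "((\<lambda>t. gf A t / Z \<alpha> t - gf B t / Z \<alpha> t) \<longlongrightarrow> a - b) (at_left t\<^sub>0)"
    using assms(2,3) by (intro tendsto_diff) (simp_all add: has_density_def)
  ultimately have "((\<lambda>t. gf (A - B) t / Z \<alpha> t) \<longlongrightarrow> a - b) (at_left t\<^sub>0)"
    by (rule Lim_transform_eventually[rotated])
  then show ?thesis using sub(1) unfolding has_density_def by (intro conjI) auto
qed

lemma has_density_UN:
  assumes "\<alpha> \<in> X" "finite F" "\<And>i. i \<in> F \<Longrightarrow> has_density \<alpha> (A i) (r i)" "disjoint_family_on A F"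
  shows "has_density \<alpha> (\<Union>i\<in>F. A i) (\<Sum>i\<in>F. r i)"
  using assms(2-)
proof (induction F rule: finite_induct)
  case empty
  then show ?case using has_density_finite[OF assms(1), of "{}"] by simp
next
  case (insert i F)
  have d: "A i \<inter> (\<Union>j\<in>F. A j) = {}" "disjoint_family_on A F"
    using insert.prems(2) disjoint_family_on_insert[OF insert.hyps(2), of A] by simp_all
  moreover have "has_density \<alpha> (\<Union>j\<in>F. A j) (\<Sum>j\<in>F. r j)"
    using insert.prems(1) d(2) by (intro insert.IH) simp_all
  ultimately have "has_density \<alpha> (A i \<union> (\<Union>j\<in>F. A j)) (r i + (\<Sum>j\<in>F. r j))"
    using insert.prems(1)[of i] by (intro has_density_Un[OF assms(1)]) simp_all
  then show ?case using insert.hyps by simp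
qed

lemma has_density_multiples:
  assumes "\<alpha> \<in> X" "x \<in> carrier M"
  shows "has_density \<alpha> (multiples \<alpha> x) (if x \<in> adm \<alpha> then t\<^sub>0 ^ len x * \<Gamma> \<alpha> (st \<alpha> x) else 0)"
proof (cases "x \<in> adm \<alpha>")
  case True
  have "((\<lambda>t. t ^ len x * (Z (st \<alpha> x) t / Z \<alpha> t)) \<longlongrightarrow> t\<^sub>0 ^ len x * \<Gamma> \<alpha> (st \<alpha> x)) (at_left t\<^sub>0)"
    by (intro tendsto_intros tendsto_parry assms st_closed True)
  then show ?thesis
    unfolding has_density_def gf_multiples[OF assms] using True by (simp add: subset_iff)
next
  case False
  then show ?thesis
    unfolding has_density_def gf_multiples[OF assms] by (simp add: subset_iff)
qed

section \<open>Traces sorted by the beginning of their normal form\<close>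

lemma finite_normal_words: "finite (normal_words n)"
proof (rule finite_subset)
  show "normal_words n \<subseteq> {h. set h \<subseteq> nonempty_cliques \<Sigma> I \<and> length h = n}"
    by (auto simp: normal_words_def is_normal_def)
qed (rule finite_lists_length_eq[OF finite_nonempty_cliques])

lemma finite_short: "finite {y \<in> carrier M. length (nf y) < n}"
proof (rule finite_subset)
  show "{y \<in> carrier M. length (nf y) < n} \<subseteq> cprod ` (\<Union>k<n. normal_words k)"
  proof
    fix y assume "y \<in> {y \<in> carrier M. length (nf y) < n}"
    then have y: "y \<in> carrier M" "length (nf y) < n" by simp_all
    then have "nf y \<in> (\<Union>k<n. normal_words k)" using normal_nf[OF y(1)] by (simp add: normal_words_def)
    then show "y \<in> cprod ` (\<Union>k<n. normal_words k)" using cprod_nf[OF y(1)] by (metis imageI)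
  qed
qed (use finite_normal_words in simp)

lemma disjoint_prefixed: "disjoint_family_on (prefixed \<alpha>) (normal_words n)"
  unfolding disjoint_family_on_def prefixed_def normal_words_def by fastforce

text \<open>\<open>divides_iff_take_nf\<close> decides divisibility on the first \<open>n\<close>
  cliques. Traces with fewer cliques are set apart; there are only finitely many, so they have
  density 0.\<close>

lemma multiples_prefixed:
  assumes "x \<in> carrier M"
  defines "n \<equiv> height \<Sigma> I x"
  shows "multiples \<alpha> x = (\<Union>h\<in>{h \<in> normal_words n. x divides\<^bsub>M\<^esub> cprod h}. prefixed \<alpha> h) \<union>
    {y \<in> multiples \<alpha> x. length (nf y) < n}" (is "_ = ?U \<union> ?R")
proof (intro equalityI subsetI)
  fix y assume y: "y \<in> multiples \<alpha> x"
  then have yc: "y \<in> carrier M" using adm_carrier by blast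
  show "y \<in> ?U \<union> ?R"
  proof (cases "length (nf y) < n")
    case False
    then have "take n (nf y) \<in> normal_words n"
      using normal_take[OF normal_nf[OF yc]] by (simp add: normal_words_def)
    moreover have "x divides\<^bsub>M\<^esub> cprod (take n (nf y))"
      using divides_iff_take_nf[OF assms(1) yc] y by (simp add: n_def)
    moreover have "y \<in> prefixed \<alpha> (take n (nf y))" using y False by (simp add: prefixed_def min_absorb1)
    ultimately show ?thesis by blast
  qed (use y in simp)
next
  fix y assume y: "y \<in> ?U \<union> ?R"
  show "y \<in> multiples \<alpha> x"
  proof (cases "y \<in> ?R")
    case False
    then obtain h where h: "h \<in> normal_words n" "x divides\<^bsub>M\<^esub> cprod h" "y \<in> prefixed \<alpha> h" using y by blast
    then have "y \<in> adm \<alpha>" "take n (nf y) = h" by (simp_all add: prefixed_def normal_words_def)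
    then show ?thesis
      using divides_iff_take_nf[OF assms(1) adm_carrier[of y \<alpha>]] h(2) by (simp add: n_def)
  qed simp
qed

lemma finite_short_multiples: "finite {y \<in> multiples \<alpha> x. length (nf y) < n}"
  using finite_short[of n] by (rule finite_subset[rotated]) (blast dest: adm_carrier)

lemma short_disjoint:
  "(\<Union>h\<in>{h \<in> normal_words n. P h}. prefixed \<alpha> h) \<inter> {y \<in> A. length (nf y) < n} = {}"
proof -
  have False if "take n (nf y) = h" "length h = n" "length (nf y) < n" for y h
    using that arg_cong[OF that(1), of length] by simp
  then show ?thesis unfolding prefixed_def normal_words_def by fastforce
qed

lemma divides_len_eq:
  assumes "x divides\<^bsub>M\<^esub> y" "x \<in> carrier M" "len y \<le> len x"
  shows "x = y"
proof -
  obtain z where z: "z \<in> carrier M" "y = x \<otimes>\<^bsub>M\<^esub> z" using assms(1) by (rule dividesE)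
  then have "len z = 0" using assms by simp
  then have "z = \<one>\<^bsub>M\<^esub>" using len_eq_0_iff[OF z(1)] by simp
  then show ?thesis using z assms(2) by simp
qed

text \<open>Downward induction on the length of \<open>h\<close>: the multiples of the product of \<open>h\<close> split, up to
  finitely many traces, into those prefixed by \<open>h\<close> and those prefixed by words with longer products.\<close>

lemma has_density_prefixed:
  assumes "\<alpha> \<in> X" "h \<in> normal_words n"
  shows "has_density \<alpha> (prefixed \<alpha> h) (trace_density \<alpha> (prefixed \<alpha> h))"
  using assms(2)
\<comment> \<open>The subtracted sum bounds the length of every product of a word in
  \<open>normal_words n\<close>, so the natural-number difference decreases strictly when the length
  grows.\<close>
proof (induction "(\<Sum>g\<in>normal_words n. len (cprod g)) - len (cprod h)" arbitrary: h rule: less_induct)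
  case less
  let ?B = "\<Sum>g\<in>normal_words n. len (cprod g)"
  have normal: "is_normal \<Sigma> I h" and n: "length h = n" using less.prems by (simp_all add: normal_words_def)
  note h = normal_cprod_closed[OF normal]
  have height: "height \<Sigma> I (cprod h) = n" using nf_cprod[OF normal] n by (simp add: Defs.height_def)
  let ?F = "{g \<in> normal_words n. cprod h divides\<^bsub>M\<^esub> cprod g}"
  define R where "R = {y \<in> multiples \<alpha> (cprod h). length (nf y) < n}"
  have hF: "h \<in> ?F" using less.prems h by (simp add: dividesI[of "\<one>\<^bsub>M\<^esub>"])
  \<comment> \<open>A multiple of equal length would be the same trace, and uniqueness of normal
    forms would give \<open>g = h\<close>. This strictness makes the system triangular.\<close>
  have longer: "len (cprod h) < len (cprod g)" if "g \<in> ?F - {h}" for g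
  proof (rule ccontr)
    assume "\<not> ?thesis"
    then have "cprod h = cprod g" using that h by (intro divides_len_eq) simp_all
    then have "h = g" using that normal by (intro normal_unique) (simp_all add: normal_words_def)
    then show False using that by simp
  qed
  have "has_density \<alpha> (prefixed \<alpha> g) (trace_density \<alpha> (prefixed \<alpha> g))" if "g \<in> ?F - {h}" for g
  proof (rule less.hyps)
    show g: "g \<in> normal_words n" using that by simp
    have "len (cprod g) \<le> ?B"
      using member_le_sum[OF g, of "\<lambda>g. len (cprod g)"] finite_normal_words by simp
    then show "?B - len (cprod g) < ?B - len (cprod h)" using longer[OF that] by linarith
  qed
  then have "has_density \<alpha> (\<Union>g\<in>?F - {h}. prefixed \<alpha> g) (\<Sum>g\<in>?F - {h}. trace_density \<alpha> (prefixed \<alpha> g))"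
    using finite_normal_words disjoint_prefixed[where \<alpha> = \<alpha> and n = n] assms(1)
    by (intro has_density_UN) (auto simp: disjoint_family_on_def)
  moreover have fR: "has_density \<alpha> R 0"
    unfolding R_def using assms(1) finite_short_multiples by (intro has_density_finite) auto
  moreover have "(\<Union>g\<in>?F - {h}. prefixed \<alpha> g) \<inter> R = {}"
    unfolding R_def using short_disjoint[where n = n and \<alpha> = \<alpha> and P = "\<lambda>g. cprod h divides\<^bsub>M\<^esub> cprod g"] by blast
  ultimately have "has_density \<alpha> ((\<Union>g\<in>?F - {h}. prefixed \<alpha> g) \<union> R)
      ((\<Sum>g\<in>?F - {h}. trace_density \<alpha> (prefixed \<alpha> g)) + 0)"
    by (intro has_density_Un assms(1))
  moreover have eq: "multiples \<alpha> (cprod h) = (\<Union>g\<in>?F. prefixed \<alpha> g) \<union> R"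
    using multiples_prefixed[OF h, of \<alpha>] unfolding height R_def .
  moreover have "(\<Union>g\<in>?F - {h}. prefixed \<alpha> g) \<union> R \<subseteq> multiples \<alpha> (cprod h)"
    unfolding eq by blast
  ultimately have "has_density \<alpha> (multiples \<alpha> (cprod h) - ((\<Union>g\<in>?F - {h}. prefixed \<alpha> g) \<union> R))
      ((if cprod h \<in> adm \<alpha> then t\<^sub>0 ^ len (cprod h) * \<Gamma> \<alpha> (st \<alpha> (cprod h)) else 0) -
       ((\<Sum>g\<in>?F - {h}. trace_density \<alpha> (prefixed \<alpha> g)) + 0))"
    by (intro has_density_Diff assms(1) has_density_multiples h)
  moreover have "multiples \<alpha> (cprod h) - ((\<Union>g\<in>?F - {h}. prefixed \<alpha> g) \<union> R) = prefixed \<alpha> h"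
  proof -
    have "prefixed \<alpha> h \<inter> prefixed \<alpha> g = {}" if "g \<in> ?F - {h}" for g
      using disjoint_prefixed[where \<alpha> = \<alpha> and n = n] less.prems that unfolding disjoint_family_on_def by blast
    moreover have "prefixed \<alpha> h \<inter> R = {}"
      unfolding R_def using short_disjoint[where n = n and \<alpha> = \<alpha> and P = "\<lambda>g. cprod h divides\<^bsub>M\<^esub> cprod g"] hF by blast
    ultimately show ?thesis unfolding eq using hF by blast
  qed
  ultimately show ?case using has_density_trace_density by simp
qed

section \<open>Finite-dimensional distributions\<close>

lemma prefix_prob_density:
  assumes "\<alpha> \<in> X" "is_normal \<Sigma> I h"
  shows "has_density \<alpha> (prefixed \<alpha> h) (prefix_prob \<alpha> h)"
  using has_density_prefixed[OF assms(1), of h "length h"] assms(2)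
  by (simp add: prefix_prob_def normal_words_def)

lemma prefix_prob_nonneg: "\<alpha> \<in> X \<Longrightarrow> 0 \<le> prefix_prob \<alpha> h"
  using has_density_nonneg[OF _ prefix_prob_density] by (cases "is_normal \<Sigma> I h") (simp_all add: prefix_prob_def)

lemma prefix_prob_Nil: "\<alpha> \<in> X \<Longrightarrow> prefix_prob \<alpha> [] = 1"
proof (rule has_density_unique)
  assume "\<alpha> \<in> X"
  then show "has_density \<alpha> (prefixed \<alpha> []) (prefix_prob \<alpha> [])" "has_density \<alpha> (prefixed \<alpha> []) 1"
    using prefix_prob_density[of \<alpha> "[]"] has_density_adm[of \<alpha>] by (simp_all add: prefixed_def)
qed

text \<open>A trace prefixed by \<open>h\<close> either has a further clique or equals
  \<open>cprod h\<close>. The second case is a single trace, which has density 0; only in the limit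
  is the family consistent.\<close>

lemma prefix_prob_snoc:
  assumes "\<alpha> \<in> X"
  shows "prefix_prob \<alpha> h = (\<Sum>c\<in>nonempty_cliques \<Sigma> I. prefix_prob \<alpha> (h @ [c]))"
proof (cases "is_normal \<Sigma> I h")
  case False
  then have "\<not> is_normal \<Sigma> I (h @ [c])" for c by (simp add: normal_append)
  then show ?thesis using False by (simp add: prefix_prob_def)
next
  case True
  let ?F = "{c \<in> nonempty_cliques \<Sigma> I. is_normal \<Sigma> I (h @ [c])}" and ?R = "adm \<alpha> \<inter> {cprod h}"
  have snoc: "y \<in> prefixed \<alpha> (h @ [c]) \<Longrightarrow> y \<in> prefixed \<alpha> h \<and> length h < length (nf y) \<and> nf y ! length h = c" for y c
  proof -
    assume "y \<in> prefixed \<alpha> (h @ [c])"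
    then have y: "y \<in> adm \<alpha>" "take (Suc (length h)) (nf y) = h @ [c]" by (simp_all add: prefixed_def)
    have l: "length h < length (nf y)" using arg_cong[OF y(2), of length] by simp
    then have "take (length h) (nf y) @ [nf y ! length h] = h @ [c]" using y(2) by (simp add: take_Suc_conv_app_nth)
    then show ?thesis using y(1) l by (simp add: prefixed_def)
  qed
  have split: "prefixed \<alpha> h = (\<Union>c\<in>?F. prefixed \<alpha> (h @ [c])) \<union> ?R"
  proof (intro equalityI subsetI)
    fix y assume "y \<in> prefixed \<alpha> h"
    then have y: "y \<in> adm \<alpha>" "take (length h) (nf y) = h" by (simp_all add: prefixed_def)
    note yc = adm_carrier[OF y(1)]
    show "y \<in> (\<Union>c\<in>?F. prefixed \<alpha> (h @ [c])) \<union> ?R"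
    proof (cases "length h < length (nf y)")
      case True
      then have t: "take (Suc (length h)) (nf y) = h @ [nf y ! length h]"
        using y(2) by (simp add: take_Suc_conv_app_nth)
      then have "is_normal \<Sigma> I (h @ [nf y ! length h])" using normal_take[OF normal_nf[OF yc]] by metis
      moreover then have "nf y ! length h \<in> nonempty_cliques \<Sigma> I" by (simp add: is_normal_def)
      moreover have "y \<in> prefixed \<alpha> (h @ [nf y ! length h])" using y t by (simp add: prefixed_def)
      ultimately show ?thesis by blast
    next
      case False
      then have "nf y = h" using y(2) by simp
      then show ?thesis using y(1) cprod_nf[OF yc] by simp
    qed
  next
    fix y assume "y \<in> (\<Union>c\<in>?F. prefixed \<alpha> (h @ [c])) \<union> ?R"
    then show "y \<in> prefixed \<alpha> h" using snoc nf_cprod[OF True] by (auto simp: prefixed_def)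
  qed
  have "has_density \<alpha> (\<Union>c\<in>?F. prefixed \<alpha> (h @ [c])) (\<Sum>c\<in>?F. prefix_prob \<alpha> (h @ [c]))"
  proof (rule has_density_UN[OF assms])
    show "disjoint_family_on (\<lambda>c. prefixed \<alpha> (h @ [c])) ?F"
      unfolding disjoint_family_on_def using snoc by blast
  qed (use finite_nonempty_cliques prefix_prob_density[OF assms] in simp_all)
  moreover have "has_density \<alpha> ?R 0" using assms by (intro has_density_finite) simp_all
  moreover have "(\<Union>c\<in>?F. prefixed \<alpha> (h @ [c])) \<inter> ?R = {}"
    using snoc nf_cprod[OF True] by fastforce
  ultimately have "has_density \<alpha> (prefixed \<alpha> h) ((\<Sum>c\<in>?F. prefix_prob \<alpha> (h @ [c])) + 0)"
    unfolding split by (rule has_density_Un[OF assms])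
  then have "prefix_prob \<alpha> h = (\<Sum>c\<in>?F. prefix_prob \<alpha> (h @ [c]))"
    using has_density_unique[OF prefix_prob_density[OF assms True]] by simp
  also have "\<dots> = (\<Sum>c\<in>nonempty_cliques \<Sigma> I. prefix_prob \<alpha> (h @ [c]))"
    using finite_nonempty_cliques by (intro sum.mono_neutral_left) (auto simp: prefix_prob_def)
  finally show ?thesis .
qed

text \<open>The density of the multiples of \<open>x\<close> is computed twice: through the
  decomposition \<open>multiples_prefixed\<close>, and through the explicit formula
  \<open>has_density_multiples\<close>.\<close>

lemma sum_prefix_prob:
  assumes "\<alpha> \<in> X" "x \<in> carrier M"
  shows "(\<Sum>h | h \<in> normal_words (height \<Sigma> I x) \<and> x divides\<^bsub>M\<^esub> cprod h. prefix_prob \<alpha> h) =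
    (if x \<in> adm \<alpha> then t\<^sub>0 ^ len x * \<Gamma> \<alpha> (st \<alpha> x) else 0)"
proof -
  let ?n = "height \<Sigma> I x"
  let ?F = "{h \<in> normal_words ?n. x divides\<^bsub>M\<^esub> cprod h}" and ?R = "{y \<in> multiples \<alpha> x. length (nf y) < ?n}"
  have "has_density \<alpha> (\<Union>h\<in>?F. prefixed \<alpha> h) (\<Sum>h\<in>?F. prefix_prob \<alpha> h)"
  proof (rule has_density_UN[OF assms(1)])
    show "disjoint_family_on (prefixed \<alpha>) ?F"
      using disjoint_prefixed[where \<alpha> = \<alpha> and n = ?n] by (simp add: disjoint_family_on_def)
    show "finite ?F" using finite_normal_words by simp
    show "has_density \<alpha> (prefixed \<alpha> h) (prefix_prob \<alpha> h)" if "h \<in> ?F" for h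
      using that by (intro prefix_prob_density assms) (simp add: normal_words_def)
  qed
  moreover have "has_density \<alpha> ?R 0"
    using assms(1) finite_short_multiples by (intro has_density_finite) auto
  ultimately have "has_density \<alpha> ((\<Union>h\<in>?F. prefixed \<alpha> h) \<union> ?R) ((\<Sum>h\<in>?F. prefix_prob \<alpha> h) + 0)"
    using short_disjoint by (intro has_density_Un[OF assms(1)])
  then have "has_density \<alpha> (multiples \<alpha> x) (\<Sum>h\<in>?F. prefix_prob \<alpha> h)"
    unfolding multiples_prefixed[OF assms(2), symmetric] by simp
  then show ?thesis using has_density_multiples[OF assms] by (rule has_density_unique)
qed

end

section \<open>The boundary measure\<close>

primrec history :: "('c list \<Rightarrow> 'c) \<Rightarrow> nat \<Rightarrow> 'c list" where
  "history \<omega> 0 = []"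
| "history \<omega> (Suc n) = history \<omega> n @ [\<omega> (history \<omega> n)]"

lemma map_history: "map (\<lambda>n. \<omega> (history \<omega> n)) [0..<n] = history \<omega> n"
  by (induction n) simp_all

text \<open>Here \<omega> is a table assigning a next symbol to every finite past. Following
  \<open>h\<close> constrains only the entries at its proper prefixes, so the event is a rectangle
  in the product space.\<close>

lemma history_eq_iff: "history \<omega> (length h) = h \<longleftrightarrow> (\<forall>i<length h. \<omega> (take i h) = h ! i)"
proof (induction h rule: rev_induct)
  case (snoc c h)
  have "history \<omega> (length (h @ [c])) = h @ [c] \<longleftrightarrow>
      history \<omega> (length h) = h \<and> \<omega> (history \<omega> (length h)) = c" by simp
  also have "\<dots> \<longleftrightarrow> (\<forall>i<length h. \<omega> (take i h) = h ! i) \<and> \<omega> h = c"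
    using snoc.IH by metis
  also have "\<dots> \<longleftrightarrow> (\<forall>i<length (h @ [c]). \<omega> (take i (h @ [c])) = (h @ [c]) ! i)"
    by (auto simp: less_Suc_eq nth_append)
  finally show ?case .
qed simp

lemma length_history [simp]: "length (history \<omega> n) = n"
  by (induction n) simp_all

lemma sets_prefix:
  fixes C :: "'c set"
  defines "P \<equiv> Pi\<^sub>M (UNIV :: nat set) (\<lambda>_. count_space C)"
  shows "{\<omega> \<in> space P. map \<omega> [0..<length h] = h} \<in> sets P"
proof -
  have "{\<omega> \<in> space P. \<forall>i<n. \<omega> i = h ! i} \<in> sets P" for n
  proof (induction n)
    case (Suc n)
    have "(\<lambda>\<omega>. \<omega> n) -` ({h ! n} \<inter> C) \<inter> space P \<in> sets P"
      unfolding P_def by (rule measurable_sets[OF measurable_component_singleton]) simp_all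
    then have "{\<omega> \<in> space P. \<forall>i<n. \<omega> i = h ! i} \<inter> ((\<lambda>\<omega>. \<omega> n) -` ({h ! n} \<inter> C) \<inter> space P) \<in> sets P"
      using Suc.IH by (rule sets.Int[rotated])
    also have "{\<omega> \<in> space P. \<forall>i<n. \<omega> i = h ! i} \<inter> ((\<lambda>\<omega>. \<omega> n) -` ({h ! n} \<inter> C) \<inter> space P) =
        {\<omega> \<in> space P. \<forall>i<Suc n. \<omega> i = h ! i}"
      by (auto simp: less_Suc_eq P_def space_PiM PiE_UNIV_domain)
    finally show ?case .
  qed simp
  moreover have "map \<omega> [0..<length h] = h \<longleftrightarrow> (\<forall>i<length h. \<omega> i = h ! i)" for \<omega>
    unfolding list_eq_iff_nth_eq[of "map \<omega> [0..<length h]" h] by simp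
  ultimately show ?thesis by (simp only:)
qed

text \<open>For every possible history \<open>h\<close> draw independently a candidate for the next symbol; the random
  sequence follows the candidates along its own history.\<close>

lemma sequence_measure:
  fixes p :: "'c list \<Rightarrow> real" and C :: "'c set"
  assumes "finite C" and p_Nil: "p [] = 1" and p_nonneg: "\<And>h. 0 \<le> p h"
    and p_snoc: "\<And>h. p h = (\<Sum>c\<in>C. p (h @ [c]))"
  obtains N :: "(nat \<Rightarrow> 'c) measure" where "prob_space N"
    "sets N = sets (Pi\<^sub>M UNIV (\<lambda>_. count_space C))"
    "\<And>h. set h \<subseteq> C \<Longrightarrow> measure N {\<omega> \<in> space N. map \<omega> [0..<length h] = h} = p h"
proof -
  have C: "C \<noteq> {}" using p_snoc[of "[]"] p_Nil by auto
  \<comment> \<open>The conditional probability of \<open>c\<close> after \<open>h\<close>. The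
    uniform default after pasts of weight 0 keeps \<open>K h\<close> a probability
    distribution.\<close>
  define K where "K h c = (if p h = 0 then 1 / real (card C) else p (h @ [c]) / p h)" for h c
  have K_nonneg: "0 \<le> K h c" for h c using p_nonneg by (simp add: K_def)
  have K_sum: "(\<Sum>c\<in>C. K h c) = 1" for h
  proof (cases "p h = 0")
    case True
    then show ?thesis using C \<open>finite C\<close> by (simp add: K_def)
  next
    case False
    then have "(\<Sum>c\<in>C. K h c) = (\<Sum>c\<in>C. p (h @ [c])) / p h"
      unfolding sum_divide_distrib by (simp add: K_def)
    then show ?thesis using False p_snoc[of h] by simp
  qed
  \<comment> \<open>After a past of weight 0 the default in \<open>K\<close> does no harm: the
    nonnegative weights of all its continuations sum to 0 and hence vanish.\<close>
  have p_K: "p (h @ [c]) = p h * K h c" if "c \<in> C" for h c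
  proof (cases "p h = 0")
    case True
    then have "\<forall>c\<in>C. p (h @ [c]) = 0"
      using p_snoc[of h] p_nonneg \<open>finite C\<close> by (simp add: sum_nonneg_eq_0_iff)
    then show ?thesis using that True by simp
  qed (simp add: K_def)
  have p_prod: "p h = (\<Prod>i<length h. K (take i h) (h ! i))" if "set h \<subseteq> C" for h
    using that
  proof (induction h rule: rev_induct)
    case (snoc c h)
    have "(\<Prod>i<length (h @ [c]). K (take i (h @ [c])) ((h @ [c]) ! i)) =
        (\<Prod>i<length h. K (take i h) (h ! i)) * K h c"
      by (simp add: nth_append)
    also have "\<dots> = p (h @ [c])" using snoc p_K[of c h] by simp
    finally show ?case by (rule HOL.sym)
  qed (simp add: p_Nil)
  define D where "D h = point_measure C (\<lambda>c. ennreal (K h c))" for h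
  have D: "prob_space (D h)" for h
    unfolding D_def using \<open>finite C\<close> K_nonneg K_sum by (intro prob_spaceI)
      (simp add: space_point_measure emeasure_point_measure_finite sum_ennreal)
  have space_D: "space (D h) = C" and sets_D: "sets (D h) = Pow C" for h
    by (simp_all add: D_def space_point_measure sets_point_measure)
  interpret P: product_prob_space D UNIV
    by (intro product_prob_spaceI D)
  let ?P = "Pi\<^sub>M UNIV D"
  let ?S = "\<lambda>\<omega> n. \<omega> (history \<omega> n)"
  have space_P: "\<omega> \<in> space ?P \<longleftrightarrow> (\<forall>l. \<omega> l \<in> C)" for \<omega>
    by (simp add: space_PiM PiE_UNIV_domain space_D Pi_iff)
  have history_C: "set (history \<omega> n) \<subseteq> C" if "\<omega> \<in> space ?P" for \<omega> n
    using that by (induction n) (simp_all add: space_P)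
  have cyl: "{\<omega> \<in> space ?P. history \<omega> (length h) = h} \<in> sets ?P"
    "emeasure ?P {\<omega> \<in> space ?P. history \<omega> (length h) = h} = ennreal (p h)" if "set h \<subseteq> C" for h
  proof -
    \<comment> \<open>The proper prefixes of \<open>h\<close>. They are distinct because their
      lengths differ, and \<open>h ! length l\<close> is the symbol following \<open>l\<close>, so
      independence produces the product in \<open>p_prod\<close>.\<close>
    define J where "J = (\<lambda>i. take i h) ` {..<length h}"
    have inj: "inj_on (\<lambda>i. take i h) {..<length h}"
      by (rule inj_on_inverseI[where g = length]) simp
    have hC: "h ! i \<in> C" if "i < length h" for i using \<open>set h \<subseteq> C\<close> that by (meson nth_mem subsetD)
    have J: "finite J" "J \<subseteq> UNIV" by (simp_all add: J_def)
    have X: "{h ! length l} \<in> sets (D l)" if "l \<in> J" for l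
      using that hC by (auto simp: sets_D J_def)
    have eq: "{\<omega> \<in> space ?P. history \<omega> (length h) = h} =
        prod_emb UNIV D J (\<Pi>\<^sub>E l\<in>J. {h ! length l})"
    proof (intro equalityI subsetI)
      fix \<omega> assume "\<omega> \<in> {\<omega> \<in> space ?P. history \<omega> (length h) = h}"
      then have w: "\<omega> \<in> space ?P" "\<forall>i<length h. \<omega> (take i h) = h ! i" by (simp_all add: history_eq_iff)
      then have "\<forall>l\<in>J. \<omega> l = h ! length l" by (simp add: J_def)
      then have "restrict \<omega> J \<in> (\<Pi>\<^sub>E l\<in>J. {h ! length l})" by (simp add: PiE_iff)
      then show "\<omega> \<in> prod_emb UNIV D J (\<Pi>\<^sub>E l\<in>J. {h ! length l})"
        using w(1) by (simp add: prod_emb_def space_PiM)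
    next
      fix \<omega> assume "\<omega> \<in> prod_emb UNIV D J (\<Pi>\<^sub>E l\<in>J. {h ! length l})"
      then have w: "\<omega> \<in> space ?P" "restrict \<omega> J \<in> (\<Pi>\<^sub>E l\<in>J. {h ! length l})"
        by (simp_all add: prod_emb_def space_PiM)
      have "\<omega> (take i h) = h ! i" if "i < length h" for i
        using PiE_mem[OF w(2), of "take i h"] that by (simp add: J_def)
      then show "\<omega> \<in> {\<omega> \<in> space ?P. history \<omega> (length h) = h}" using w(1) by (simp add: history_eq_iff)
    qed
    show "{\<omega> \<in> space ?P. history \<omega> (length h) = h} \<in> sets ?P"
      unfolding eq using J X by (intro sets_PiM_I) blast+
    have "emeasure ?P (prod_emb UNIV D J (\<Pi>\<^sub>E l\<in>J. {h ! length l})) = (\<Prod>l\<in>J. emeasure (D l) {h ! length l})"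
      using J X by (intro P.emeasure_PiM_emb) simp_all
    also have "\<dots> = (\<Prod>i<length h. emeasure (D (take i h)) {h ! i})"
      unfolding J_def by (simp add: prod.reindex[OF inj])
    also have "\<dots> = (\<Prod>i<length h. ennreal (K (take i h) (h ! i)))"
      using \<open>finite C\<close> hC by (intro prod.cong HOL.refl) (simp add: D_def emeasure_point_measure_finite)
    also have "\<dots> = ennreal (p h)"
      unfolding p_prod[OF that] using K_nonneg by (intro prod_ennreal)
    finally show "emeasure ?P {\<omega> \<in> space ?P. history \<omega> (length h) = h} = ennreal (p h)"
      unfolding eq .
  qed
  have S: "?S \<in> measurable ?P (Pi\<^sub>M UNIV (\<lambda>_. count_space C))"
  proof (rule measurable_PiM_single')
    fix n :: nat
    show "(\<lambda>\<omega>. \<omega> (history \<omega> n)) \<in> measurable ?P (count_space C)"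
      unfolding measurable_count_space_eq2[OF \<open>finite C\<close>]
    proof (intro conjI ballI)
      show "(\<lambda>\<omega>. \<omega> (history \<omega> n)) \<in> space ?P \<rightarrow> C" by (simp add: space_P)
      fix c assume c: "c \<in> C"
      \<comment> \<open>The coordinate that is read depends on the random past, so the event is
        split over the finitely many pasts of length \<open>n\<close>; each piece is a history
        event.\<close>
      have "(\<lambda>\<omega>. \<omega> (history \<omega> n)) -` {c} \<inter> space ?P =
          (\<Union>h\<in>{h. set h \<subseteq> C \<and> length h = n}. {\<omega> \<in> space ?P. history \<omega> (length (h @ [c])) = h @ [c]})"
        using history_C by auto
      also have "\<dots> \<in> sets ?P"
      proof (intro sets.finite_UN)
        show "finite {h. set h \<subseteq> C \<and> length h = n}" using \<open>finite C\<close> by (rule finite_lists_length_eq)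
        fix h assume "h \<in> {h. set h \<subseteq> C \<and> length h = n}"
        then show "{\<omega> \<in> space ?P. history \<omega> (length (h @ [c])) = h @ [c]} \<in> sets ?P"
          using c by (intro cyl(1)) simp
      qed
      finally show "(\<lambda>\<omega>. \<omega> (history \<omega> n)) -` {c} \<inter> space ?P \<in> sets ?P" .
    qed
  qed (simp add: space_P PiE_UNIV_domain)
  let ?N = "distr ?P (Pi\<^sub>M UNIV (\<lambda>_. count_space C)) ?S"
  show ?thesis
  proof (rule that[of ?N])
    show "prob_space ?N" using S by (rule P.P.prob_space_distr)
    show "sets ?N = sets (Pi\<^sub>M UNIV (\<lambda>_. count_space C))" by simp
    fix h assume h: "set h \<subseteq> C"
    let ?A = "{\<omega> \<in> space ?N. map \<omega> [0..<length h] = h}"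
    have A: "?A \<in> sets (Pi\<^sub>M UNIV (\<lambda>_. count_space C))"
      unfolding space_distr by (rule sets_prefix)
    have "?S -` ?A \<inter> space ?P = {\<omega> \<in> space ?P. history \<omega> (length h) = h}"
      using measurable_space[OF S] unfolding space_distr vimage_def mem_Collect_eq map_history by blast
    then show "measure ?N ?A = p h"
      using measure_distr[OF S A] cyl(2)[OF h] p_nonneg[of h] by (simp add: measure_def)
  qed
qed

context irreducible_partial_action
begin

section \<open>From sequences of cliques to the boundary\<close>

lemma boundary_prefix_normal: "\<xi> \<in> boundary \<Sigma> I \<Longrightarrow> is_normal \<Sigma> I (map \<xi> [0..<n])"
proof (induction n)
  case (Suc n)
  have "normal_arrow I (last (map \<xi> [0..<n])) (\<xi> n)" if "n \<noteq> 0"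
    using that Suc.prems by (cases n) (simp_all add: boundary_def)
  then show ?case
    using Suc by (simp add: normal_append normal_Cons boundary_def)
qed simp

lemma not_boundary_prefix:
  assumes "\<forall>i. \<xi> i \<in> nonempty_cliques \<Sigma> I" "\<xi> \<notin> boundary \<Sigma> I"
  obtains n where "\<not> is_normal \<Sigma> I (map \<xi> [0..<n])"
proof -
  obtain i where i: "\<not> normal_arrow I (\<xi> i) (\<xi> (Suc i))" using assms by (auto simp: boundary_def)
  have "\<not> is_normal \<Sigma> I (map \<xi> [0..<Suc (Suc i)])"
    using i by (simp add: normal_append normal_Cons)
  then show ?thesis by (rule that)
qed

text \<open>\<open>sequence_measure\<close> yields a law on all sequences of nonempty cliques. It is
  concentrated on the boundary, to which it is restricted; cylinders then become finite unions of
  prefix events, evaluated by \<open>sum_prefix_prob\<close>.\<close>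

lemma boundary_measure:
  assumes "\<alpha> \<in> X"
  shows "\<exists>\<nu>. prob_space \<nu> \<and> sets \<nu> = sets (boundary_space \<Sigma> I) \<and>
    (\<forall>x\<in>carrier M. measure \<nu> (cylinder \<Sigma> I x) =
      (if x \<in> adm \<alpha> then t\<^sub>0 ^ len x * \<Gamma> \<alpha> (st \<alpha> x) else 0))"
proof -
  let ?C = "nonempty_cliques \<Sigma> I" and ?B = "boundary \<Sigma> I"
  obtain N :: "(nat \<Rightarrow> 'a trace) measure" where N: "prob_space N"
    "sets N = sets (Pi\<^sub>M UNIV (\<lambda>_. count_space ?C))"
    "\<And>h. set h \<subseteq> ?C \<Longrightarrow> measure N {\<omega> \<in> space N. map \<omega> [0..<length h] = h} = prefix_prob \<alpha> h"
    using sequence_measure[of ?C "prefix_prob \<alpha>", OF finite_nonempty_cliques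
      prefix_prob_Nil[OF assms] prefix_prob_nonneg[OF assms] prefix_prob_snoc[OF assms]] by blast
  interpret N: prob_space N by (rule N(1))
  have space_N: "\<omega> \<in> space N \<longleftrightarrow> (\<forall>i. \<omega> i \<in> ?C)" for \<omega>
    using sets_eq_imp_space_eq[OF N(2)] by (simp add: space_PiM PiE_UNIV_domain Pi_iff)
  define W where "W h = {\<omega> \<in> space N. map \<omega> [0..<length h] = h}" for h
  have sets_W: "W h \<in> sets N" for h
    unfolding W_def N(2) sets_eq_imp_space_eq[OF N(2)] by (rule sets_prefix)
  \<comment> \<open>A sequence of nonempty cliques lies outside the boundary exactly when some
    finite prefix is not normal. Such words are countably many, each of weight 0 by the default in
    \<open>prefix_prob\<close>.\<close>
  define bad where "bad = (\<Union>h\<in>{h \<in> lists ?C. \<not> is_normal \<Sigma> I h}. W h)"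
  have null: "bad \<in> null_sets N"
    unfolding bad_def
  proof (rule null_sets_UN')
    show "countable {h \<in> lists ?C. \<not> is_normal \<Sigma> I h}"
      using countable_lists[OF countable_finite[OF finite_nonempty_cliques]]
      by (rule countable_subset[rotated]) blast
    fix h assume h: "h \<in> {h \<in> lists ?C. \<not> is_normal \<Sigma> I h}"
    then have "measure N (W h) = prefix_prob \<alpha> h"
      unfolding W_def by (intro N(3)) (simp add: in_lists_conv_set subset_eq)
    then have "measure N (W h) = 0" using h by (simp add: prefix_prob_def)
    then show "W h \<in> null_sets N" using sets_W N.emeasure_eq_measure by (intro null_setsI) simp_all
  qed
  have B: "?B = space N - bad"
  proof (intro equalityI subsetI)
    fix \<xi> assume \<xi>: "\<xi> \<in> ?B"
    then have "\<xi> \<in> space N" by (simp add: space_N boundary_def)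
    moreover have "\<xi> \<notin> bad"
    proof
      assume "\<xi> \<in> bad"
      then obtain h where "\<not> is_normal \<Sigma> I h" "map \<xi> [0..<length h] = h" by (auto simp: bad_def W_def)
      then show False using boundary_prefix_normal[OF \<xi>, of "length h"] by simp
    qed
    ultimately show "\<xi> \<in> space N - bad" by simp
  next
    fix \<xi> assume \<xi>: "\<xi> \<in> space N - bad"
    show "\<xi> \<in> ?B"
    proof (rule ccontr)
      assume "\<xi> \<notin> ?B"
      moreover have "\<forall>i. \<xi> i \<in> ?C" using \<xi> by (simp add: space_N)
      ultimately obtain n where n: "\<not> is_normal \<Sigma> I (map \<xi> [0..<n])" by (blast elim: not_boundary_prefix)
      have "map \<xi> [0..<n] \<in> lists ?C" using \<open>\<forall>i. \<xi> i \<in> ?C\<close> by (simp add: in_lists_conv_set)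
      moreover have "\<xi> \<in> W (map \<xi> [0..<n])" using \<xi> by (simp add: W_def)
      ultimately show False using n \<xi> unfolding bad_def by blast
    qed
  qed
  have sets_B: "?B \<in> sets N" unfolding B using null by blast
  have emeasure_B: "emeasure N ?B = 1"
    unfolding B using emeasure_Diff_null_set[OF null sets.top] N.emeasure_space_1 by simp
  let ?F = "\<lambda>x. {h \<in> normal_words (height \<Sigma> I x). x divides\<^bsub>M\<^esub> cprod h}"
  \<comment> \<open>Membership is decided by the prefix of length
    \<open>height \<Sigma> I x\<close>, so up to the null set \<open>bad\<close> a cylinder is a
    finite union of prefix events.\<close>
  have cyl: "cylinder \<Sigma> I x = (\<Union>h\<in>?F x. W h) - bad" for x
  proof (intro equalityI subsetI)
    fix \<xi> assume "\<xi> \<in> cylinder \<Sigma> I x"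
    then have \<xi>: "\<xi> \<in> ?B" "x divides\<^bsub>M\<^esub> cprod (map \<xi> [0..<height \<Sigma> I x])" by (simp_all add: cylinder_def)
    let ?h = "map \<xi> [0..<height \<Sigma> I x]"
    have "?h \<in> ?F x" using \<xi> boundary_prefix_normal by (simp add: normal_words_def)
    moreover have "\<xi> \<in> W ?h" using \<xi>(1) unfolding B by (simp add: W_def)
    ultimately show "\<xi> \<in> (\<Union>h\<in>?F x. W h) - bad" using \<xi>(1) unfolding B by blast
  next
    fix \<xi> assume "\<xi> \<in> (\<Union>h\<in>?F x. W h) - bad"
    then obtain h where h: "h \<in> ?F x" "\<xi> \<in> W h" "\<xi> \<notin> bad" by blast
    then have "\<xi> \<in> ?B" unfolding B by (simp add: W_def)
    moreover have "map \<xi> [0..<height \<Sigma> I x] = h" using h by (simp add: W_def normal_words_def)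
    ultimately show "\<xi> \<in> cylinder \<Sigma> I x" using h(1) by (simp add: cylinder_def)
  qed
  have finite_F: "finite (?F x)" for x using finite_normal_words by simp
  have sets_UN: "(\<Union>h\<in>?F x. W h) \<in> sets N" for x using finite_F sets_W by (intro sets.finite_UN)
  have sets_cyl: "cylinder \<Sigma> I x \<in> sets N" for x
    unfolding cyl using sets_UN null by blast
  let ?R = "restrict_space N ?B"
  \<comment> \<open>Pushing forward along the identity only replaces the sigma-algebra by the one
    generated by the cylinders.\<close>
  let ?\<nu> = "distr ?R (boundary_space \<Sigma> I) (\<lambda>\<xi>. \<xi>)"
  have cyl_B: "cylinder \<Sigma> I x \<subseteq> ?B" for x by (auto simp: cylinder_def)
  have space_R: "space ?R = ?B" using sets.sets_into_space[OF sets_B] by (auto simp: space_restrict_space)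
  have sets_R: "cylinder \<Sigma> I x \<in> sets ?R" for x
    using sets_B sets_cyl cyl_B sets.sets_into_space[OF sets_B] by (subst sets_restrict_space_iff) (simp_all add: Int_absorb2)
  have meas: "(\<lambda>\<xi>. \<xi>) \<in> measurable ?R (boundary_space \<Sigma> I)"
    unfolding boundary_space_def
  proof (rule measurable_measure_of)
    show "cylinder \<Sigma> I ` carrier M \<subseteq> Pow ?B" using cyl_B by blast
    show "(\<lambda>\<xi>. \<xi>) \<in> space ?R \<rightarrow> ?B" by (simp add: space_R)
    fix A assume "A \<in> cylinder \<Sigma> I ` carrier M"
    then show "(\<lambda>\<xi>. \<xi>) -` A \<inter> space ?R \<in> sets ?R" using sets_R cyl_B by (auto simp: space_R Int_absorb2)
  qed
  have "prob_space ?R" using sets_B emeasure_B by (rule prob_space_restrict_space)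
  then have "prob_space ?\<nu>" using meas by (rule prob_space.prob_space_distr)
  moreover have "measure ?\<nu> (cylinder \<Sigma> I x) = (if x \<in> adm \<alpha> then t\<^sub>0 ^ len x * \<Gamma> \<alpha> (st \<alpha> x) else 0)"
    if x: "x \<in> carrier M" for x
  proof -
    have "cylinder \<Sigma> I x \<in> sets (boundary_space \<Sigma> I)"
      unfolding boundary_space_def using x cyl_B by (subst sets_measure_of) auto
    then have "measure ?\<nu> (cylinder \<Sigma> I x) = measure ?R (cylinder \<Sigma> I x)"
      using meas cyl_B[of x] by (simp add: measure_distr space_R Int_absorb2)
    also have "\<dots> = measure N (cylinder \<Sigma> I x)"
      using sets_B cyl_B sets.sets_into_space[OF sets_B]
      by (intro measure_restrict_space) (simp_all add: Int_absorb2)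
    also have "\<dots> = measure N (\<Union>h\<in>?F x. W h)"
      unfolding cyl using null sets_UN by (intro measure_Diff_null_set)
    also have "\<dots> = (\<Sum>h\<in>?F x. measure N (W h))"
    proof (rule N.finite_measure_finite_Union)
      show "disjoint_family_on W (?F x)"
      proof (unfold disjoint_family_on_def, intro ballI impI equals0I)
        fix g h \<xi> assume gh: "g \<in> ?F x" "h \<in> ?F x" "g \<noteq> h" "\<xi> \<in> W g \<inter> W h"
        then have "length g = length h" by (simp add: normal_words_def)
        moreover have "map \<xi> [0..<length g] = g" "map \<xi> [0..<length h] = h" using gh(4) by (simp_all add: W_def)
        ultimately show False using gh(3) by metis
      qed
    qed (use finite_F sets_W in blast)+
    also have "\<dots> = (\<Sum>h\<in>?F x. prefix_prob \<alpha> h)"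
    proof (intro sum.cong HOL.refl)
      fix h assume "h \<in> ?F x"
      then show "measure N (W h) = prefix_prob \<alpha> h"
        unfolding W_def by (intro N(3)) (simp add: normal_words_def is_normal_def)
    qed
    also have "\<dots> = (if x \<in> adm \<alpha> then t\<^sub>0 ^ len x * \<Gamma> \<alpha> (st \<alpha> x) else 0)"
      by (rule sum_prefix_prob[OF assms x])
    finally show ?thesis .
  qed
  ultimately show ?thesis by (intro exI[of _ ?\<nu>]) simp
qed

end

theorem theorem6:
  fixes \<Sigma> :: "'a set" and I :: "'a rel"
    and X :: "'s set" and E :: "'s \<Rightarrow> 'a set" and \<delta> :: "'s \<Rightarrow> 'a \<Rightarrow> 's"
  assumes "partial_action \<Sigma> I X E \<delta>"
    and "finite X"
    and "irreducible_action X E \<delta>"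
  shows "\<exists>\<nu> :: 's \<Rightarrow> (nat \<Rightarrow> 'a trace) measure.
    (\<forall>\<alpha>\<in>X. prob_space (\<nu> \<alpha>) \<and> sets (\<nu> \<alpha>) = sets (boundary_space \<Sigma> I)) \<and>
    (\<forall>\<alpha>\<in>X. \<forall>x\<in>admissible \<Sigma> I E \<delta> \<alpha>.
       measure (\<nu> \<alpha>) (cylinder \<Sigma> I x) =
         char_root \<Sigma> I X E \<delta> ^ trace_length x * parry_cocycle \<Sigma> I X E \<delta> \<alpha> (act E \<delta> \<alpha> x)) \<and>
    (\<forall>\<alpha>\<in>X. \<forall>x\<in>carrier (trace_monoid \<Sigma> I) - admissible \<Sigma> I E \<delta> \<alpha>.
       measure (\<nu> \<alpha>) (cylinder \<Sigma> I x) = 0) \<and>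
    (\<forall>\<alpha>\<in>X. \<forall>x\<in>admissible \<Sigma> I E \<delta> \<alpha>. \<forall>y\<in>carrier (trace_monoid \<Sigma> I).
       measure (\<nu> \<alpha>) (cylinder \<Sigma> I (x \<otimes>\<^bsub>trace_monoid \<Sigma> I\<^esub> y)) =
         measure (\<nu> \<alpha>) (cylinder \<Sigma> I x) * measure (\<nu> (act E \<delta> \<alpha> x)) (cylinder \<Sigma> I y)) \<and>
    (\<forall>\<alpha>\<in>X. \<forall>x\<in>carrier (trace_monoid \<Sigma> I).
       measure (\<nu> \<alpha>) (cylinder \<Sigma> I x) > 0 \<longleftrightarrow> x \<in> admissible \<Sigma> I E \<delta> \<alpha>)"
proof -
  interpret irreducible_partial_action \<Sigma> I X E \<delta>
    using assms by (simp add: irreducible_partial_action_def irreducible_partial_action_axioms_def)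
  have "\<forall>\<alpha>\<in>X. \<exists>\<nu>. prob_space \<nu> \<and> sets \<nu> = sets (boundary_space \<Sigma> I) \<and>
    (\<forall>x\<in>carrier M. measure \<nu> (cylinder \<Sigma> I x) =
      (if x \<in> adm \<alpha> then t\<^sub>0 ^ len x * \<Gamma> \<alpha> (st \<alpha> x) else 0))"
    using boundary_measure by blast
  then obtain \<nu> where "\<forall>\<alpha>\<in>X. prob_space (\<nu> \<alpha>) \<and> sets (\<nu> \<alpha>) = sets (boundary_space \<Sigma> I) \<and>
    (\<forall>x\<in>carrier M. measure (\<nu> \<alpha>) (cylinder \<Sigma> I x) =
      (if x \<in> adm \<alpha> then t\<^sub>0 ^ len x * \<Gamma> \<alpha> (st \<alpha> x) else 0))"
    by (rule bchoice[THEN exE])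
  then have prob: "\<And>\<alpha>. \<alpha> \<in> X \<Longrightarrow> prob_space (\<nu> \<alpha>) \<and> sets (\<nu> \<alpha>) = sets (boundary_space \<Sigma> I)"
    and val: "\<And>\<alpha> x. \<alpha> \<in> X \<Longrightarrow> x \<in> carrier M \<Longrightarrow> measure (\<nu> \<alpha>) (cylinder \<Sigma> I x) =
      (if x \<in> adm \<alpha> then t\<^sub>0 ^ len x * \<Gamma> \<alpha> (st \<alpha> x) else 0)"
    by blast+
  have pos: "0 < t\<^sub>0 ^ len x * \<Gamma> \<alpha> (st \<alpha> x)" if "\<alpha> \<in> X" "x \<in> adm \<alpha>" for \<alpha> x
  proof -
    have "X \<noteq> {}" using that(1) by blast
    then show ?thesis
      using char_root_pos parry_pos[OF that(1) st_closed[OF that]] by (intro mult_pos_pos zero_less_power)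
  qed
  have mult: "measure (\<nu> \<alpha>) (cylinder \<Sigma> I (x \<otimes>\<^bsub>M\<^esub> y)) =
      measure (\<nu> \<alpha>) (cylinder \<Sigma> I x) * measure (\<nu> (st \<alpha> x)) (cylinder \<Sigma> I y)"
    if "\<alpha> \<in> X" "x \<in> adm \<alpha>" "y \<in> carrier M" for \<alpha> x y
  proof -
    note x = adm_carrier[OF that(2)] and \<beta> = st_closed[OF that(1,2)]
    note iff = adm_mult_iff[OF that(1) x that(3)]
    show ?thesis
    proof (cases "y \<in> adm (st \<alpha> x)")
      case True
      \<comment> \<open>The cocycle identity along \<alpha>, its image under \<open>x\<close> and
        the further image under \<open>y\<close>, together with additivity of length, gives the
        product formula. For inadmissible \<open>y\<close> both sides vanish.\<close>
      have "\<Gamma> \<alpha> (st (st \<alpha> x) y) = \<Gamma> \<alpha> (st \<alpha> x) * \<Gamma> (st \<alpha> x) (st (st \<alpha> x) y)"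
        using parry_cocycle_mult[OF that(1) \<beta> st_closed[OF \<beta> True]] by simp
      then show ?thesis
        using val[OF that(1) x] val[OF \<beta> that(3)] val[OF that(1) M.m_closed[OF x that(3)]] iff True that
          st_mult[OF that(1) x that(3,2)] len_mult[OF x that(3)]
        by (simp add: power_add mult_ac)
    next
      case False
      then show ?thesis
        using val[OF \<beta> that(3)] val[OF that(1) M.m_closed[OF x that(3)]] iff by simp
    qed
  qed
  show ?thesis
    using prob val pos mult adm_carrier by (intro exI[of _ \<nu>] conjI ballI) simp_all
qed

end
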